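(* Let $K\ge 1$, let $f_1$ be the pdf of $CFUSN(\mu_1,\Omega_1,\Lambda_1)$ on $\mathbb{R}^K$ (for some admissible parameters), and let $\Gamma_1=\Omega_1-\Lambda_1\Lambda_1'$. Let $$\mathcal{P}_0=\{CFUSN(\mu,\Omega,\Lambda):\ \Gamma\neq\Gamma_1,\ \text{and } \Gamma_1-\Gamma\neq kvv' \text{ for any column } v \text{ of } \Lambda \text{ and any real } k>0\},$$ where $(\mu,\Omega,\Lambda)$ ranges over all admissible parameters on $\mathbb{R}^K$ and $\Gamma=\Omega-\Lambda\Lambda'$. Then the family of mixture pdfs $\mathcal{F}(\mathcal{P}_0,f_1)$ is identifiable.
   Context: Canonical fundamental skew normal family (CFUSN): admissible parameters are $\mu\in\mathbb{R}^K$, a $K\times K$ (symmetric positive definite) covariance matrix $\Omega$, and a real $K\times K$ matrix $\Lambda$ such that $\Gamma=\Omega-\Lambda\Lambda'$ is positive semi-definite (equivalently $\Delta=I_K-\Lambda'\Omega^{-1}\Lambda$ is positive semi-definite, i.e. a covariance matrix; $\Delta=(I_K+\Lambda'\Gamma^{-1}\Lambda)^{-1}$ when $\Gamma$ is invertible). $CFUSN(\mu,\Omega,\Lambda)$ is the distribution on $\mathbb{R}^K$ with pdf $2^K\phi_K(x-\mu\,|\,\Omega)\,\Phi_K\left(\Lambda'\Omega^{-1}(x-\mu)\,|\,\Delta\right)$, where $\phi_K(\cdot|\Omega)$ is the pdf of the $K$-dimensional normal distribution with mean zero and covariance $\Omega$, $\Phi_K(\cdot|\Delta)$ is the cdf of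 the $K$-dimensional normal distribution with mean zero and covariance $\Delta$, $I_K$ is the identity matrix and $'$ denotes transpose. Distributions are identified with their pdfs. Mixtures with one known component: for a set $\mathcal{P}_0$ of pdfs on $\mathbb{R}^K$ and a fixed pdf $f_1$ on $\mathbb{R}^K$, put $f(\alpha,f_0)=\alpha f_1+(1-\alpha)f_0$ for $\alpha\in(0,1)$, $f_0\in\mathcal{P}_0$, and $\mathcal{F}(\mathcal{P}_0,f_1)=\{f(\alpha,f_0):\alpha\in(0,1),f_0\in\mathcal{P}_0\}$. The family $\mathcal{F}(\mathcal{P}_0,f_1)$ is identifiable if for all $a,b\in(0,1)$ and all $h_0,g_0\in\mathcal{P}_0$, $f(a,h_0)=f(b,g_0)$ implies $(a,h_0)=(b,g_0)$. *)

theory Defs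
  imports "HOL-Probability.Probability"
begin

definition pos_semidef :: "real ^ 'n ^ 'n \<Rightarrow> bool" where
  "pos_semidef A \<longleftrightarrow> transpose A = A \<and> (\<forall>x. 0 \<le> x \<bullet> (A *v x))"

definition pos_def :: "real ^ 'n ^ 'n \<Rightarrow> bool" where
  "pos_def A \<longleftrightarrow> transpose A = A \<and> (\<forall>x. x \<noteq> 0 \<longrightarrow> 0 < x \<bullet> (A *v x))"

definition std_normal_vec :: "(real ^ 'n) measure" where
  "std_normal_vec = density lborel (\<lambda>x. ennreal (\<Prod>i\<in>UNIV. std_normal_density (x $ i)))"

text \<open>For positive semi-definite \<open>S\<close>, possibly singular, the normal distribution with mean zero
  and covariance matrix \<open>S\<close> is the law of \<open>A Z\<close> with \<open>Z\<close> standard normal and \<open>A A' = S\<close>.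
  Such an \<open>A\<close> exists, and the law does not depend on which one is chosen.\<close>

definition centered_normal :: "real ^ 'n ^ 'n \<Rightarrow> (real ^ 'n) measure" where
  "centered_normal S = distr std_normal_vec borel ((*v) (SOME A :: real ^ 'n ^ 'n. A ** transpose A = S))"

definition normal_cdf :: "real ^ 'n \<Rightarrow> real ^ 'n ^ 'n \<Rightarrow> real" where
  "normal_cdf y S = measure (centered_normal S) {x. \<forall>i. x $ i \<le> y $ i}"

definition normal_pdf :: "real ^ 'n \<Rightarrow> real ^ 'n ^ 'n \<Rightarrow> real" where
  "normal_pdf x S =
     exp (- (x \<bullet> (matrix_inv S *v x)) / 2) / sqrt ((2 * pi) ^ CARD('n) * det S)"

definition cfusn_Gamma :: "real ^ 'n ^ 'n \<Rightarrow> real ^ 'n ^ 'n \<Rightarrow> real ^ 'n ^ 'n" where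
  "cfusn_Gamma \<Omega> \<Lambda> = \<Omega> - \<Lambda> ** transpose \<Lambda>"

definition cfusn_Delta :: "real ^ 'n ^ 'n \<Rightarrow> real ^ 'n ^ 'n \<Rightarrow> real ^ 'n ^ 'n" where
  "cfusn_Delta \<Omega> \<Lambda> = mat 1 - transpose \<Lambda> ** matrix_inv \<Omega> ** \<Lambda>"

definition cfusn_admissible :: "real ^ 'n ^ 'n \<Rightarrow> real ^ 'n ^ 'n \<Rightarrow> bool" where
  "cfusn_admissible \<Omega> \<Lambda> \<longleftrightarrow> pos_def \<Omega> \<and> pos_semidef (cfusn_Gamma \<Omega> \<Lambda>)"

definition cfusn_pdf ::
  "real ^ 'n \<Rightarrow> real ^ 'n ^ 'n \<Rightarrow> real ^ 'n ^ 'n \<Rightarrow> real ^ 'n \<Rightarrow> real" where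
  "cfusn_pdf \<mu> \<Omega> \<Lambda> x =
     2 ^ CARD('n) * normal_pdf (x - \<mu>) \<Omega> *
     normal_cdf ((transpose \<Lambda> ** matrix_inv \<Omega>) *v (x - \<mu>)) (cfusn_Delta \<Omega> \<Lambda>)"

definition CFUSN ::
  "real ^ 'n \<Rightarrow> real ^ 'n ^ 'n \<Rightarrow> real ^ 'n ^ 'n \<Rightarrow> (real ^ 'n) measure" where
  "CFUSN \<mu> \<Omega> \<Lambda> = density lborel (\<lambda>x. ennreal (cfusn_pdf \<mu> \<Omega> \<Lambda> x))"

text \<open>A distribution determines its pdf only up to Lebesgue null sets; every version of the
  density counts as a pdf of it.\<close>

definition is_pdf_of :: "(real ^ 'n \<Rightarrow> real) \<Rightarrow> (real ^ 'n) measure \<Rightarrow> bool" where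
  "is_pdf_of f M \<longleftrightarrow>
     f \<in> borel_measurable borel \<and> (\<forall>x. 0 \<le> f x) \<and> M = density lborel (\<lambda>x. ennreal (f x))"

definition mix :: "('a \<Rightarrow> real) \<Rightarrow> real \<Rightarrow> ('a \<Rightarrow> real) \<Rightarrow> 'a \<Rightarrow> real" where
  "mix f1 \<alpha> f0 = (\<lambda>x. \<alpha> * f1 x + (1 - \<alpha>) * f0 x)"

text \<open>Identifiability of the family of all \<open>mix f1 \<alpha> f0\<close> with \<open>0 < \<alpha> < 1\<close> and \<open>f0 \<in> P0\<close>; it is
  a property of the parametrisation, hence of the pair \<open>P0\<close>, \<open>f1\<close>.\<close>

definition mixture_identifiable :: "('a \<Rightarrow> real) set \<Rightarrow> ('a \<Rightarrow> real) \<Rightarrow> bool" where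
  "mixture_identifiable P0 f1 \<longleftrightarrow>
     (\<forall>a\<in>{0<..<1}. \<forall>b\<in>{0<..<1}. \<forall>h0\<in>P0. \<forall>g0\<in>P0.
        mix f1 a h0 = mix f1 b g0 \<longrightarrow> (a, h0) = (b, g0))"

definition outer_square :: "real ^ 'n \<Rightarrow> real ^ 'n ^ 'n" where
  "outer_square v = (\<chi> i j. v $ i * v $ j)"

definition cfusn_P0 :: "real ^ 'n ^ 'n \<Rightarrow> (real ^ 'n \<Rightarrow> real) set" where
  "cfusn_P0 \<Gamma>1 =
     {f. \<exists>\<mu> \<Omega> \<Lambda>. cfusn_admissible \<Omega> \<Lambda> \<and> is_pdf_of f (CFUSN \<mu> \<Omega> \<Lambda>) \<and>
           cfusn_Gamma \<Omega> \<Lambda> \<noteq> \<Gamma>1 \<and>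
           (\<forall>j k. k > 0 \<longrightarrow> \<Gamma>1 - cfusn_Gamma \<Omega> \<Lambda> \<noteq> k *\<^sub>R outer_square (column j \<Lambda>))}"

end

theory Submission
  imports Defs "HOL-Complex_Analysis.Complex_Analysis" "HOL-Real_Asymp.Real_Asymp"
begin

text \<open>
  If identifiability fails, one member \<open>g\<close> of the family is a proper convex combination
  \<open>g = c f1 + (1 - c) h\<close> of \<open>f1\<close> and another member \<open>h\<close>. The moment generating function of
  \<open>CFUSN(\<mu>, \<Omega>, \<Lambda>)\<close> at \<open>t\<close> is \<open>exp (t' \<mu> + t' \<Omega> t / 2)\<close> times the product over the columns
  \<open>\<lambda>\<close> of \<open>\<Lambda>\<close> of \<open>2 \<Phi>(t' \<lambda>)\<close>. Fix a single direction \<open>t\<close> in which the quadratic form of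
  \<open>\<Gamma>1\<close> differs from those of \<open>g\<close> and of \<open>h\<close>, and continue the identity between the three
  generating functions along the line \<open>s t\<close> to imaginary \<open>s = i y\<close>. There the squared modulus of
  each of them is \<open>exp (- y\<^sup>2 t' \<Gamma> t)\<close> times a product of factors
  \<open>exp (- (l y)\<^sup>2) \<Phi>(0)\<^sup>2 + D(l y)\<^sup>2\<close>, where \<open>l = t' \<lambda>\<close> and \<open>D\<close> is Dawson's function, and this
  product has a nonzero asymptotic expansion in powers of \<open>1 / y\<^sup>2\<close>. Hence the smallest of the
  three Gaussian rates is attained twice, which leaves only \<open>t' \<Gamma>g t = t' \<Gamma>h t < t' \<Gamma>1 t\<close>. Up to
  an exponentially small error, the product for \<open>g\<close> is then \<open>(1 - c)\<^sup>2\<close> times the one for \<open>h\<close>,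
  so the two asymptotic series are proportional. Their logarithmic derivatives show that the
  numbers \<open>1 / l\<^sup>2\<close> have the same power sums for \<open>g\<close> and for \<open>h\<close>, hence the same product, and
  comparing leading coefficients gives \<open>(1 - c)\<^sup>2 = 1\<close>, a contradiction.
\<close>

section \<open>Formal power series\<close>

unbundle no vec_syntax

section \<open>Rescaling and logarithmic derivatives of formal power series\<close>

definition fps_scale :: "real \<Rightarrow> real fps \<Rightarrow> real fps" where
  "fps_scale c f = f oo (fps_const c * fps_X)"

lemma fps_scale_nth: "fps_scale c f $ k = c ^ k * f $ k"
  unfolding fps_scale_def by (simp add: fps_compose_linear)

lemma fps_scale_mult: "fps_scale c (f * g) = fps_scale c f * fps_scale c g"
  unfolding fps_scale_def by (rule fps_compose_mult_distrib) simp

lemma fps_deriv_scale: "fps_deriv (fps_scale c f) = fps_const c * fps_scale c (fps_deriv f)"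
  by (rule fps_ext) (simp add: fps_scale_nth)

lemma fps_prod_nth_0: "(\<Prod>i\<in>I. f i) $ 0 = (\<Prod>i\<in>I. f i $ 0 :: real)"
  by (induction I rule: infinite_finite_induct) auto

text \<open>The quotient f' / f, meaningful when the constant coefficient is nonzero. It turns the
  products in the later expansions into sums, from which power sums can be read off.\<close>

definition fps_logderiv :: "real fps \<Rightarrow> real fps" where
  "fps_logderiv f = fps_deriv f * inverse f"

lemma fps_logderiv_mult:
  assumes "f $ 0 \<noteq> 0" "g $ 0 \<noteq> 0"
  shows "fps_logderiv (f * g) = fps_logderiv f + fps_logderiv g"
proof -
  have "f * inverse f = 1" "g * inverse g = 1"
    using assms by (simp_all add: inverse_mult_eq_1')
  moreover have "inverse (f * g) = inverse f * inverse g"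
    by (rule fps_inverse_mult)
  ultimately show ?thesis
    unfolding fps_logderiv_def fps_deriv_mult by algebra
qed

lemma fps_logderiv_prod:
  assumes "finite I" "\<And>i. i \<in> I \<Longrightarrow> f i $ 0 \<noteq> 0"
  shows "fps_logderiv (\<Prod>i\<in>I. f i) = (\<Sum>i\<in>I. fps_logderiv (f i))"
proof -
  \<comment> \<open>The nonzero constant coefficient is carried through the induction because the
    product rule asks for it.\<close>
  have "fps_logderiv (\<Prod>i\<in>I. f i) = (\<Sum>i\<in>I. fps_logderiv (f i)) \<and> (\<Prod>i\<in>I. f i) $ 0 \<noteq> 0"
    using assms
  proof (induction I rule: finite_induct)
    case empty
    then show ?case by (simp add: fps_logderiv_def)
  next
    case (insert i I)
    then show ?case by (simp add: fps_logderiv_mult)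
  qed
  then show ?thesis by blast
qed

text \<open>The chain rule supplies one factor c beyond the c ^ k of the rescaled coefficient.
  Summed over rescaled copies of one series, the coefficients become multiples of the power sums of
  the scales.\<close>

lemma fps_logderiv_scale:
  "f $ 0 \<noteq> 0 \<Longrightarrow> fps_logderiv (fps_scale c f) $ k = c ^ Suc k * fps_logderiv f $ k"
proof -
  assume f: "f $ 0 \<noteq> 0"
  have "fps_scale c f * fps_scale c (inverse f) = fps_scale c (f * inverse f)"
    by (simp add: fps_scale_mult)
  also have "\<dots> = 1"
    using f by (simp add: inverse_mult_eq_1' fps_scale_def)
  finally have "fps_scale c f * fps_scale c (inverse f) = 1" .
  then have "inverse (fps_scale c f) = fps_scale c (inverse f)"
    by (simp add: fps_inverse_unique)
  then have "fps_logderiv (fps_scale c f) = fps_const c * fps_scale c (fps_logderiv f)"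
    unfolding fps_logderiv_def by (simp add: fps_deriv_scale fps_scale_mult mult.assoc)
  then show ?thesis by (simp add: fps_scale_nth)
qed

text \<open>The quotient f / g has derivative zero, so over the reals it equals its constant
  coefficient, which is 1.\<close>

lemma fps_logderiv_cancel:
  assumes "f $ 0 = 1" "g $ 0 = 1" "fps_logderiv f = fps_logderiv g"
  shows "f = g"
proof -
  have "f * inverse f = 1" "g * inverse g = 1"
    using assms by (simp_all add: inverse_mult_eq_1')
  moreover have "fps_deriv f * inverse f = fps_deriv g * inverse g"
    using assms(3) by (simp add: fps_logderiv_def)
  ultimately have eq: "fps_deriv f * g = fps_deriv g * f" by algebra
  have "fps_deriv (inverse g) = - fps_deriv g * (inverse g)\<^sup>2"
    by (rule fps_inverse_deriv) (use assms in simp)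
  then have "fps_deriv (f * inverse g) = 0"
    using eq \<open>g * inverse g = 1\<close> unfolding fps_deriv_mult by algebra
  then have "f * inverse g = fps_const ((f * inverse g) $ 0)"
    by (simp only: fps_deriv_eq_0_iff)
  also have "\<dots> = 1" using assms by simp
  finally show ?thesis using \<open>g * inverse g = 1\<close> by algebra
qed

section \<open>Power sums determine the product\<close>

lemma prod_linear_fps_nth:
  assumes "finite I"
  shows "(\<Prod>i\<in>I. 1 - fps_const (\<alpha> i) * fps_X) $ card I = (\<Prod>i\<in>I. - \<alpha> i :: real)"
proof -
  \<comment> \<open>A degree bound joins the induction: the new top coefficient is
    \<open>- \<alpha> i\<close> times the old one only because the old product has no coefficient at
    \<open>Suc (card I)\<close>.\<close>
  have "(\<Prod>i\<in>I. 1 - fps_const (\<alpha> i) * fps_X) $ card I = (\<Prod>i\<in>I. - \<alpha> i :: real) \<and>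
        (\<forall>k > card I. (\<Prod>i\<in>I. 1 - fps_const (\<alpha> i) * fps_X) $ k = 0)"
    using assms
  proof (induction I rule: finite_induct)
    case empty
    then show ?case by simp
  next
    case (insert i I)
    have "((1 - fps_const (\<alpha> i) * fps_X) * p) $ Suc k = p $ Suc k - \<alpha> i * p $ k" for p k
      by (simp add: left_diff_distrib mult.assoc)
    moreover have "\<exists>j. k = Suc j \<and> j > card I" if "k > Suc (card I)" for k
      using that by (cases k) auto
    ultimately show ?case using insert by fastforce
  qed
  then show ?thesis by blast
qed

text \<open>Newton's identities as generating functions: the logarithmic derivative of the product
  of the polynomials 1 - \<alpha> X has the negated power sums as coefficients, so equal power sums
  force equal polynomials. As the cardinalities agree, the top coefficients have the same index and
  are the two products up to a common sign.\<close>

lemma prod_eq_if_power_sums_eq: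
  fixes \<alpha> :: "'a \<Rightarrow> real" and \<beta> :: "'b \<Rightarrow> real"
  assumes "finite I" "finite J" "card I = card J"
    and sums: "\<And>k. (\<Sum>i\<in>I. \<alpha> i ^ Suc k) = (\<Sum>j\<in>J. \<beta> j ^ Suc k)"
  shows "(\<Prod>i\<in>I. \<alpha> i) = (\<Prod>j\<in>J. \<beta> j)"
proof -
  have ld: "fps_logderiv (1 - fps_const a * fps_X) $ k = - (a ^ Suc k)" for a k
  proof -
    have "1 - fps_const a * fps_X = fps_scale a (1 - fps_X)"
      by (simp add: fps_scale_def fps_compose_sub_distrib)
    moreover have "fps_logderiv (1 - fps_X) $ k = -1"
      by (simp add: fps_logderiv_def fps_inverse_one_minus_fps_X flip: fps_const_neg)
    ultimately show ?thesis by (simp add: fps_logderiv_scale)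
  qed
  let ?A = "\<Prod>i\<in>I. 1 - fps_const (\<alpha> i) * fps_X" and ?B = "\<Prod>j\<in>J. 1 - fps_const (\<beta> j) * fps_X"
  have "fps_logderiv ?A = fps_logderiv ?B"
  proof (rule fps_ext)
    fix k
    show "fps_logderiv ?A $ k = fps_logderiv ?B $ k"
      using sums[of k] assms(1,2)
      by (simp add: fps_logderiv_prod fps_sum_nth ld sum_negf del: power_Suc)
  qed
  moreover have "?A $ 0 = 1" "?B $ 0 = 1"
    by (simp_all add: fps_prod_nth_0)
  ultimately have "?A = ?B" by (metis fps_logderiv_cancel)
  then have "(\<Prod>i\<in>I. - \<alpha> i) = (\<Prod>j\<in>J. - \<beta> j)"
    using prod_linear_fps_nth[OF assms(1), of \<alpha>] prod_linear_fps_nth[OF assms(2), of \<beta>] assms(3)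
    by simp
  then show ?thesis
    using assms(3) by (simp add: prod_uminus)
qed

text \<open>The series 1 + X + 3 X^2 + 15 X^3 + ... of odd double factorials. In X = 1 / y^2 it is
  the divergent expansion at infinity of y D(y), where D' = 1 - y D.\<close>

definition dawson_fps :: "real fps" where
  "dawson_fps = Abs_fps (\<lambda>k. \<Prod>j<k. 2 * real j + 1)"

lemma dawson_fps_0 [simp]: "dawson_fps $ 0 = 1"
  by (simp add: dawson_fps_def)

text \<open>Dawson's equation in the variable X = 1 / y^2; on coefficients it is the recursion from
  s_k to (2 k + 1) s_k.\<close>

lemma dawson_fps_ode: "dawson_fps = 1 + fps_X * dawson_fps + 2 * fps_X ^ 2 * fps_deriv dawson_fps"
proof (rule fps_ext)
  fix k
  have X2: "(2 * fps_X ^ 2 * f) $ k = (if k < 2 then 0 else 2 * f $ (k - 2))" for k and f :: "real fps"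
    by (simp add: mult.assoc fps_numeral_fps_const fps_X_power_mult_nth)
  show "dawson_fps $ k = (1 + fps_X * dawson_fps + 2 * fps_X ^ 2 * fps_deriv dawson_fps) $ k"
  proof (cases k)
    case (Suc j)
    then show ?thesis
      by (cases j) (simp_all add: X2, simp_all add: dawson_fps_def algebra_simps)
  qed (simp add: X2)
qed

text \<open>The logarithmic derivative satisfies a Riccati equation all of whose coefficients are nonnegative.\<close>

lemma dawson_logderiv_pos: "fps_logderiv dawson_fps $ k > 0"
proof -
  define S where "S = dawson_fps"
  define T where "T = fps_logderiv S"
  define R where "R = inverse S"
  have 1: "S * R = 1" by (simp add: R_def S_def inverse_mult_eq_1')
  have T: "T = fps_deriv S * R" by (simp add: T_def R_def fps_logderiv_def)
  have ode: "S = 1 + fps_X * S + 2 * fps_X ^ 2 * fps_deriv S"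
    unfolding S_def by (rule dawson_fps_ode)
  \<comment> \<open>Dividing the equation by \<open>S\<close> expresses \<open>R\<close> through
    \<open>T\<close>. Differentiating \<open>R\<close> in two ways, once as - S' R^2 = - T R, then
    gives the Riccati equation \<open>T_eq\<close>.\<close>
  have R: "R = 1 - fps_X - 2 * fps_X ^ 2 * T"
    using 1 ode T by algebra
  have "fps_deriv R = - fps_deriv S * R ^ 2"
    unfolding R_def by (rule fps_inverse_deriv) (simp add: S_def)
  moreover have "fps_deriv R = - 1 - 4 * fps_X * T - 2 * fps_X ^ 2 * fps_deriv T"
    by (subst R) (simp add: fps_deriv_power' algebra_simps)
  ultimately have T_eq: "T = 1 + fps_X * (5 * T + fps_X * (2 * fps_deriv T + 2 * T * T))"
    using T R by algebra
  have "T $ k > 0"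
  proof (induction k rule: less_induct)
    case (less k)
    show ?case
    proof (cases k)
      case 0
      then show ?thesis by (subst T_eq) simp
    next
      case (Suc j)
      have num: "(numeral n * f) $ i = numeral n * f $ i" for n i and f :: "real fps"
        by (simp add: fps_numeral_fps_const)
      have Tk: "T $ k = 5 * T $ j + (fps_X * (2 * fps_deriv T + 2 * T * T)) $ j"
        by (subst T_eq) (simp add: Suc num)
      have "(fps_X * (2 * fps_deriv T + 2 * T * T)) $ j \<ge> 0"
      proof (cases j)
        case (Suc i)
        have "(T * T) $ i \<ge> 0"
          unfolding fps_mult_nth
          by (intro sum_nonneg mult_nonneg_nonneg less_imp_le less) (use Suc \<open>k = Suc j\<close> in auto)
        moreover have "T $ Suc i > 0" using Suc \<open>k = Suc j\<close> less by simp
        ultimately show ?thesis using Suc by (simp add: num mult.assoc)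
      qed simp
      moreover have "T $ j > 0" using Suc less by simp
      ultimately show ?thesis using Tk by simp
    qed
  qed
  then show ?thesis by (simp add: T_def S_def)
qed

text \<open>The expansion in X = 1 / y^2 of q exp (- (l y)^2) + D(l y)^2, with r = k^2 when D' = k -
  y D and D(0) = 0. For l = 0 the factor is the constant q. Otherwise the Gaussian term is smaller
  than every power, and D(l y)^2 is the square of l y D(l y) divided by (l y)^2.\<close>

definition dawson_factor :: "real \<Rightarrow> real \<Rightarrow> real \<Rightarrow> real fps" where
  "dawson_factor q r l =
     (if l = 0 then fps_const q
      else fps_scale (1 / l\<^sup>2) (fps_const r * (fps_X * (dawson_fps * dawson_fps))))"

text \<open>Splits a factor into a scalar, a power of X and a series with constant coefficient 1, a
  form that multiplies well over an index set.\<close>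

lemma dawson_factor_eq:
  "dawson_factor q r l =
    fps_const (if l = 0 then q else r / l\<^sup>2) * fps_X ^ (if l = 0 then 0 else 1) *
    (if l = 0 then 1 else fps_scale (1 / l\<^sup>2) dawson_fps * fps_scale (1 / l\<^sup>2) dawson_fps)"
proof (cases "l = 0")
  case False
  have "fps_scale c (fps_const r * f) = fps_const r * fps_scale c f" for c f
    by (rule fps_ext) (simp add: fps_scale_nth)
  moreover have "fps_scale c fps_X = fps_const c * fps_X" for c
    by (simp add: fps_scale_def)
  ultimately have "dawson_factor q r l = fps_const r * (fps_const (1 / l\<^sup>2) * fps_X *
      (fps_scale (1 / l\<^sup>2) dawson_fps * fps_scale (1 / l\<^sup>2) dawson_fps))"
    using False by (simp add: dawson_factor_def fps_scale_mult)
  moreover have "fps_const (r / l\<^sup>2) = fps_const r * fps_const (1/l\<^sup>2)"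
    by simp
  ultimately show ?thesis using False by (simp only: if_False power_one_right mult.assoc)
qed (simp add: dawson_factor_def)

lemma prod_dawson_factor:
  assumes "finite I"
  shows "(\<Prod>i\<in>I. dawson_factor q r (l i)) =
    fps_const (q ^ card {i\<in>I. l i = 0} * r ^ card {i\<in>I. l i \<noteq> 0} * (\<Prod>i\<in>{i\<in>I. l i \<noteq> 0}. 1 / (l i)\<^sup>2)) *
    fps_X ^ card {i\<in>I. l i \<noteq> 0} *
    (\<Prod>i\<in>{i\<in>I. l i \<noteq> 0}. fps_scale (1 / (l i)\<^sup>2) dawson_fps * fps_scale (1 / (l i)\<^sup>2) dawson_fps)"
  using assms
proof (induction I rule: finite_induct)
  case (insert i I)
  let ?c = "q ^ card {i\<in>I. l i = 0} * r ^ card {i\<in>I. l i \<noteq> 0} * (\<Prod>i\<in>{i\<in>I. l i \<noteq> 0}. 1 / (l i)\<^sup>2)"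
  show ?case
  proof (cases "l i = 0")
    case True
    then have sets: "{j \<in> insert i I. l j = 0} = insert i {j\<in>I. l j = 0}"
      "{j \<in> insert i I. l j \<noteq> 0} = {j\<in>I. l j \<noteq> 0}" by auto
    have c: "fps_const (q * ?c) = fps_const q * fps_const ?c" by simp
    have prod: "(\<Prod>j\<in>insert i I. dawson_factor q r (l j)) = fps_const q * (\<Prod>j\<in>I. dawson_factor q r (l j))"
      using insert.hyps True by (simp add: dawson_factor_def)
    show ?thesis
      unfolding prod insert.IH sets mult.assoc[symmetric] c[symmetric]
      using insert.hyps by (simp add: mult.assoc)
  next
    case False
    then have sets: "{j \<in> insert i I. l j = 0} = {j\<in>I. l j = 0}"
      "{j \<in> insert i I. l j \<noteq> 0} = insert i {j\<in>I. l j \<noteq> 0}" by auto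
    let ?S = "fps_scale (1 / (l i)\<^sup>2) dawson_fps * fps_scale (1 / (l i)\<^sup>2) dawson_fps"
    have card: "card (insert i {j\<in>I. l j \<noteq> 0}) = Suc (card {j\<in>I. l j \<noteq> 0})"
      and prods: "prod f (insert i {j\<in>I. l j \<noteq> 0}) = f i * prod f {j\<in>I. l j \<noteq> 0}" for f :: "'a \<Rightarrow> 'c::comm_monoid_mult"
      using insert.hyps by auto
    have c: "q ^ card {i\<in>I. l i = 0} * r ^ Suc (card {i\<in>I. l i \<noteq> 0}) * (1 / (l i)\<^sup>2 * (\<Prod>i\<in>{i\<in>I. l i \<noteq> 0}. 1 / (l i)\<^sup>2))
        = r / (l i)\<^sup>2 * ?c" by simp
    have prod: "(\<Prod>j\<in>insert i I. dawson_factor q r (l j)) = fps_const (r / (l i)\<^sup>2) * fps_X * ?S * (\<Prod>j\<in>I. dawson_factor q r (l j))"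
      using insert.hyps False by (simp add: dawson_factor_eq)
    show ?thesis
      unfolding prod insert.IH sets card prods c fps_const_mult[symmetric] by (simp only: power_Suc mult_ac)
  qed
qed simp

text \<open>Power series over the reals have no zero divisors. Nonvanishing is what later rules out
  decay faster than every power.\<close>

lemma prod_dawson_factor_nonzero:
  assumes "finite I" "q > 0" "r > 0"
  shows "(\<Prod>i\<in>I. dawson_factor q r (l i)) \<noteq> 0"
proof -
  have "dawson_factor q r (l i) \<noteq> 0" for i
  proof -
    have "fps_scale c dawson_fps \<noteq> 0" for c
    proof -
      have "fps_scale c dawson_fps $ 0 \<noteq> 0" by (simp add: fps_scale_nth)
      then show ?thesis by (metis fps_zero_nth)
    qed
    then show ?thesis using assms by (simp add: dawson_factor_eq)
  qed
  then show ?thesis using assms by simp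
qed

text \<open>The order of vanishing counts the nonzero numbers, and after removing leading
  coefficients the unit parts coincide. Their logarithmic derivatives determine the power sums of
  the 1 / (a i)^2, hence the product of these numbers; comparing leading coefficients then leaves
  only d = 1.\<close>

lemma dawson_factor_prod_rigid:
  fixes a :: "'a \<Rightarrow> real" and b :: "'b \<Rightarrow> real"
  assumes fin: "finite I" "finite J" "card I = card J"
    and qrd: "q > 0" "r > 0" "d > 0"
    and eq: "(\<Prod>i\<in>I. dawson_factor q r (a i)) = fps_const d * (\<Prod>j\<in>J. dawson_factor q r (b j))"
  shows "d = 1"
proof -
  define I0 where "I0 = {i\<in>I. a i \<noteq> 0}"
  define J0 where "J0 = {j\<in>J. b j \<noteq> 0}"
  define P where "P = (\<Prod>i\<in>I0. fps_scale (1 / (a i)\<^sup>2) dawson_fps * fps_scale (1 / (a i)\<^sup>2) dawson_fps)"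
  define Q where "Q = (\<Prod>j\<in>J0. fps_scale (1 / (b j)\<^sup>2) dawson_fps * fps_scale (1 / (b j)\<^sup>2) dawson_fps)"
  define A where "A = q ^ card {i\<in>I. a i = 0} * r ^ card I0 * (\<Prod>i\<in>I0. 1 / (a i)\<^sup>2)"
  define B where "B = d * (q ^ card {j\<in>J. b j = 0} * r ^ card J0 * (\<Prod>j\<in>J0. 1 / (b j)\<^sup>2))"
  have fin0: "finite I0" "finite J0" using fin by (auto simp: I0_def J0_def)
  have P0: "P $ 0 = 1" and Q0: "Q $ 0 = 1"
    by (simp_all add: P_def Q_def fps_prod_nth_0 fps_scale_nth)
  have prods: "(\<Prod>i\<in>I0. 1 / (a i)\<^sup>2) > 0" "(\<Prod>j\<in>J0. 1 / (b j)\<^sup>2) > 0"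
    by (auto intro!: prod_pos simp: I0_def J0_def)
  have AB: "A > 0" "B > 0" using prods qrd by (simp_all add: A_def B_def)
  have eq': "fps_const A * fps_X ^ card I0 * P = fps_const B * fps_X ^ card J0 * Q"
    using eq unfolding prod_dawson_factor[OF fin(1)] prod_dawson_factor[OF fin(2)]
    by (simp add: A_def B_def P_def Q_def I0_def J0_def mult.assoc)
  have sub: "subdegree (fps_const c * fps_X ^ n * F) = n" if "c > 0" "F $ 0 = 1" for c n and F :: "real fps"
    using that
    by (intro subdegreeI) (auto simp: mult.assoc fps_X_power_mult_nth)
  have card: "card I0 = card J0"
    using sub[OF AB(1) P0, of "card I0"] sub[OF AB(2) Q0, of "card J0"] eq' by simp
  have nth: "(fps_const c * fps_X ^ n * F) $ (n + k) = c * F $ k" for c n k and F :: "real fps"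
    by (simp add: mult.assoc fps_X_power_mult_nth)
  have coeffs: "A * P $ k = B * Q $ k" for k
    by (metis nth card eq')
  from coeffs[of 0] have "A = B" using P0 Q0 by simp
  then have PQ: "P = Q" using coeffs AB by (auto intro!: fps_ext)
  \<comment> \<open>Equally many nonzero numbers leave equally many zeros, so the powers of q and r
    will cancel from A = B.\<close>
  have "card {i\<in>I. a i = 0} = card {j\<in>J. b j = 0}"
  proof -
    have "card I = card {i\<in>I. a i = 0} + card I0"
      unfolding I0_def using fin(1) by (subst card_Un_disjoint[symmetric]) (auto intro: arg_cong[of _ _ card])
    moreover have "card J = card {j\<in>J. b j = 0} + card J0"
      unfolding J0_def using fin(2) by (subst card_Un_disjoint[symmetric]) (auto intro: arg_cong[of _ _ card])
    ultimately show ?thesis using card fin by simp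
  qed
  with \<open>A = B\<close> card qrd have prod: "(\<Prod>i\<in>I0. 1 / (a i)\<^sup>2) = d * (\<Prod>j\<in>J0. 1 / (b j)\<^sup>2)"
    by (simp add: A_def B_def)
  have ld: "fps_logderiv (\<Prod>i\<in>K. fps_scale (c i) dawson_fps * fps_scale (c i) dawson_fps) $ k =
      2 * fps_logderiv dawson_fps $ k * (\<Sum>i\<in>K. c i ^ Suc k)" if "finite K" for K :: "'c set" and c k
    using that
    by (simp add: fps_logderiv_prod fps_logderiv_mult fps_scale_nth fps_logderiv_scale fps_sum_nth
        sum_distrib_left mult_ac)
  have sums: "(\<Sum>i\<in>I0. (1 / (a i)\<^sup>2) ^ Suc k) = (\<Sum>j\<in>J0. (1 / (b j)\<^sup>2) ^ Suc k)" for k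
  proof -
    \<comment> \<open>Both coefficients are twice \<open>fps_logderiv dawson_fps $ k\<close> times a
      power sum; positivity of that number allows it to be cancelled.\<close>
    have "fps_logderiv P $ k = fps_logderiv Q $ k" using PQ by simp
    then show ?thesis
      unfolding P_def Q_def ld[OF fin0(1)] ld[OF fin0(2)]
      using dawson_logderiv_pos[of k] by simp
  qed
  have "(\<Prod>i\<in>I0. 1 / (a i)\<^sup>2) = (\<Prod>j\<in>J0. 1 / (b j)\<^sup>2)"
    by (rule prod_eq_if_power_sums_eq) (use fin0 card sums in auto)
  then show ?thesis using prod prods by simp
qed

section \<open>Asymptotic expansions\<close>

text \<open>A Poincare expansion at infinity in powers of 1 / y^2, with no demand of convergence.
  The case N = 0 says that f is bounded near infinity.\<close>

definition has_asymp :: "(real \<Rightarrow> real) \<Rightarrow> real fps \<Rightarrow> bool" where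
  "has_asymp f s \<longleftrightarrow> (\<forall>N. (\<lambda>y. f y - (\<Sum>k<N. s $ k * (1 / y\<^sup>2) ^ k)) \<in> O(\<lambda>y. (1 / y\<^sup>2) ^ N))"

section \<open>Closure and uniqueness of asymptotic expansions\<close>

lemma inverse_square_power_bigo: "m \<le> n \<Longrightarrow> (\<lambda>y::real. (1 / y\<^sup>2) ^ n) \<in> O(\<lambda>y. (1 / y\<^sup>2) ^ m)"
proof (rule bigoI[of _ 1])
  assume mn: "m \<le> n"
  show "eventually (\<lambda>y::real. norm ((1 / y\<^sup>2) ^ n) \<le> 1 * norm ((1 / y\<^sup>2) ^ m)) at_top"
    using eventually_ge_at_top[of 1]
  proof eventually_elim
    case (elim y)
    then have "1 / y\<^sup>2 \<le> 1" by simp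
    then show ?case using power_decreasing[OF mn, of "1 / y\<^sup>2"] by (simp add: norm_power)
  qed
qed

lemma poly_inverse_square_bigo: "(\<lambda>y::real. \<Sum>k<N. c k * (1 / y\<^sup>2) ^ k) \<in> O(\<lambda>_. 1)"
proof (rule big_sum_in_bigo)
  fix k
  have "(\<lambda>y::real. (1 / y\<^sup>2) ^ k) \<in> O(\<lambda>_. 1)"
    using inverse_square_power_bigo[of 0 k] by simp
  then show "(\<lambda>y::real. c k * (1 / y\<^sup>2) ^ k) \<in> O(\<lambda>_. 1)" by simp
qed

lemma has_asymp_bounded: "has_asymp f s \<Longrightarrow> f \<in> O(\<lambda>_. 1)"
  unfolding has_asymp_def by (drule spec[of _ 0]) simp

lemma has_asymp_cong:
  assumes "has_asymp f s" "eventually (\<lambda>y. f y = g y) at_top"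
  shows "has_asymp g s"
  unfolding has_asymp_def
proof
  fix N
  have "(\<lambda>y. f y - (\<Sum>k<N. s $ k * (1 / y\<^sup>2) ^ k)) \<in> O(\<lambda>y. (1 / y\<^sup>2) ^ N)"
    using assms(1) by (simp add: has_asymp_def)
  then show "(\<lambda>y. g y - (\<Sum>k<N. s $ k * (1 / y\<^sup>2) ^ k)) \<in> O(\<lambda>y. (1 / y\<^sup>2) ^ N)"
    by (rule landau_o.big.in_cong[THEN iffD1, rotated]) (use assms(2) in eventually_elim, simp)
qed

lemma has_asymp_add:
  assumes "has_asymp f s" "has_asymp g t"
  shows "has_asymp (\<lambda>y. f y + g y) (s + t)"
  unfolding has_asymp_def
proof
  fix N
  have "(\<lambda>y. (f y - (\<Sum>k<N. s $ k * (1 / y\<^sup>2) ^ k)) + (g y - (\<Sum>k<N. t $ k * (1 / y\<^sup>2) ^ k)))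
      \<in> O(\<lambda>y. (1 / y\<^sup>2) ^ N)"
    using assms by (intro sum_in_bigo(1)) (simp_all add: has_asymp_def)
  then show "(\<lambda>y. f y + g y - (\<Sum>k<N. (s + t) $ k * (1 / y\<^sup>2) ^ k)) \<in> O(\<lambda>y. (1 / y\<^sup>2) ^ N)"
    by (simp add: algebra_simps sum.distrib)
qed

text \<open>The truncated Cauchy product differs from the product of the truncations only in terms
  with i + j \<ge> N, which are within the allowed error.\<close>

lemma has_asymp_mult:
  assumes "has_asymp f s" "has_asymp g t"
  shows "has_asymp (\<lambda>y. f y * g y) (s * t)"
  unfolding has_asymp_def
proof
  fix N
  define P where "P = (\<lambda>y::real. \<Sum>k<N. s $ k * (1 / y\<^sup>2) ^ k)"
  define Q where "Q = (\<lambda>y::real. \<Sum>k<N. t $ k * (1 / y\<^sup>2) ^ k)"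
  define T where "T = {(i, j). i + j < N}"
  define h where "h = (\<lambda>(i, j) (y::real). s $ i * t $ j * (1 / y\<^sup>2) ^ (i + j))"
  have T: "T \<subseteq> {..<N} \<times> {..<N}" by (auto simp: T_def)
  have "(\<Sum>k<N. (s * t) $ k * (1 / y\<^sup>2) ^ k) = (\<Sum>p\<in>T. h p y)" for y
  proof -
    have "(\<Sum>p\<in>T. h p y) = (\<Sum>(i, j)\<in>{(i, j). i + j < N}. s $ i * t $ j * (1 / y\<^sup>2) ^ (i + j))"
      by (simp add: T_def h_def case_prod_unfold)
    also have "\<dots> = (\<Sum>k<N. \<Sum>i\<le>k. s $ i * t $ (k - i) * (1 / y\<^sup>2) ^ (i + (k - i)))"
      by (rule sum.triangle_reindex)
    also have "\<dots> = (\<Sum>k<N. (s * t) $ k * (1 / y\<^sup>2) ^ k)"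
      by (intro sum.cong refl) (simp add: fps_mult_nth sum_distrib_right atLeast0AtMost)
    finally show ?thesis by simp
  qed
  moreover have "P y * Q y = (\<Sum>p\<in>T. h p y) + (\<Sum>p\<in>{..<N} \<times> {..<N} - T. h p y)" for y
  proof -
    have "P y * Q y = (\<Sum>p\<in>{..<N} \<times> {..<N}. h p y)"
      by (simp add: P_def Q_def h_def sum_product sum.cartesian_product power_add mult_ac case_prod_unfold)
    then show ?thesis using sum.subset_diff[OF T, of "\<lambda>p. h p y"] by simp
  qed
  \<comment> \<open>The error consists of that of \<open>f\<close>, that of \<open>g\<close>, each
    times a bounded function, and the index pairs outside the triangle \<open>T\<close>.\<close>
  ultimately have split: "f y * g y - (\<Sum>k<N. (s * t) $ k * (1 / y\<^sup>2) ^ k) =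
      (f y - P y) * g y + P y * (g y - Q y) + (\<Sum>p\<in>{..<N} \<times> {..<N} - T. h p y)" for y
    by (simp add: algebra_simps)
  have "(\<lambda>y. (f y - P y) * g y) \<in> O(\<lambda>y. (1 / y\<^sup>2) ^ N * 1)"
    using assms has_asymp_bounded[OF assms(2)]
    by (intro landau_o.big.mult) (simp_all add: has_asymp_def P_def)
  moreover have "(\<lambda>y. P y * (g y - Q y)) \<in> O(\<lambda>y. 1 * (1 / y\<^sup>2) ^ N)"
    using assms poly_inverse_square_bigo[of "fps_nth s" N]
    by (intro landau_o.big.mult) (simp_all add: has_asymp_def P_def Q_def)
  moreover have "(\<lambda>y. \<Sum>p\<in>{..<N} \<times> {..<N} - T. h p y) \<in> O(\<lambda>y. (1 / y\<^sup>2) ^ N)"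
  proof (rule big_sum_in_bigo)
    fix p assume "p \<in> {..<N} \<times> {..<N} - T"
    then have "N \<le> fst p + snd p" by (auto simp: T_def)
    from inverse_square_power_bigo[OF this] show "h p \<in> O(\<lambda>y. (1 / y\<^sup>2) ^ N)"
      by (cases "s $ fst p * t $ snd p = 0") (auto simp: h_def case_prod_unfold)
  qed
  ultimately show "(\<lambda>y. f y * g y - (\<Sum>k<N. (s * t) $ k * (1 / y\<^sup>2) ^ k)) \<in> O(\<lambda>y. (1 / y\<^sup>2) ^ N)"
    unfolding split by (intro sum_in_bigo) simp_all
qed

lemma has_asymp_const: "has_asymp (\<lambda>_. c) (fps_const c)"
  unfolding has_asymp_def
proof
  fix N
  show "(\<lambda>y. c - (\<Sum>k<N. fps_const c $ k * (1 / y\<^sup>2) ^ k)) \<in> O(\<lambda>y. (1 / y\<^sup>2) ^ N)"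
  proof (cases N)
    case (Suc n)
    have "(\<Sum>k<N. fps_const c $ k * (1 / y\<^sup>2) ^ k) = c" for y :: real
    proof -
      have "(\<Sum>k<N. fps_const c $ k * (1 / y\<^sup>2) ^ k) = (\<Sum>k\<in>{0}. fps_const c $ k * (1 / y\<^sup>2) ^ k)"
        by (rule sum.mono_neutral_right) (auto simp: Suc)
      then show ?thesis by simp
    qed
    then show ?thesis by simp
  qed simp
qed

lemma has_asymp_inverse_square: "has_asymp (\<lambda>y. 1 / y\<^sup>2) fps_X"
  unfolding has_asymp_def
proof
  fix N
  show "(\<lambda>y::real. 1 / y\<^sup>2 - (\<Sum>k<N. fps_X $ k * (1 / y\<^sup>2) ^ k)) \<in> O(\<lambda>y. (1 / y\<^sup>2) ^ N)"
  proof (cases "N \<le> 1")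
    case True
    then have "(\<Sum>k<N. fps_X $ k * (1 / y\<^sup>2) ^ k) = 0" for y :: real
      by (intro sum.neutral) auto
    then show ?thesis using inverse_square_power_bigo[OF True] by (simp only: power_one_right diff_zero)
  next
    case False
    have "(\<Sum>k<N. fps_X $ k * (1 / y\<^sup>2) ^ k) = 1 / y\<^sup>2" for y :: real
    proof -
      have "(\<Sum>k<N. fps_X $ k * (1 / y\<^sup>2) ^ k) = (\<Sum>k\<in>{1}. fps_X $ k * (1 / y\<^sup>2) ^ k)"
        by (rule sum.mono_neutral_right) (use False in auto)
      then show ?thesis by simp
    qed
    then show ?thesis by simp
  qed
qed

lemma has_asymp_prod:
  assumes "finite I" "\<And>i. i \<in> I \<Longrightarrow> has_asymp (f i) (s i)"
  shows "has_asymp (\<lambda>y. \<Prod>i\<in>I. f i y) (\<Prod>i\<in>I. s i)"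
  using assms
proof (induction I rule: finite_induct)
  case empty
  then show ?case using has_asymp_const[of 1] by simp
next
  case (insert i I)
  then show ?case by (simp add: has_asymp_mult)
qed

lemma has_asymp_scale:
  assumes "has_asymp f s" "l > 0"
  shows "has_asymp (\<lambda>y. f (l * y)) (fps_scale (1 / l\<^sup>2) s)"
  unfolding has_asymp_def
proof
  fix N
  have lim: "filterlim (\<lambda>y. l * y) at_top at_top"
    using assms(2) by (intro filterlim_tendsto_pos_mult_at_top[OF tendsto_const]) (auto simp: filterlim_ident)
  have "(\<lambda>y. f y - (\<Sum>k<N. s $ k * (1 / y\<^sup>2) ^ k)) \<in> O(\<lambda>y. (1 / y\<^sup>2) ^ N)"
    using assms(1) by (simp add: has_asymp_def)
  from landau_o.big.compose[OF this lim]
  have "(\<lambda>y. f (l * y) - (\<Sum>k<N. s $ k * (1 / (l * y)\<^sup>2) ^ k)) \<in> O(\<lambda>y. (1 / (l * y)\<^sup>2) ^ N)" .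
  moreover have "(1 / (l * y)\<^sup>2) ^ k = (1 / l\<^sup>2) ^ k * (1 / y\<^sup>2) ^ k" for k y
    by (simp add: power_mult_distrib power_divide)
  ultimately show "(\<lambda>y. f (l * y) - (\<Sum>k<N. fps_scale (1 / l\<^sup>2) s $ k * (1 / y\<^sup>2) ^ k))
      \<in> O(\<lambda>y. (1 / y\<^sup>2) ^ N)"
    using assms(2) by (simp add: fps_scale_nth mult_ac)
qed

text \<open>Gaussian decay beats every power, so exponentially small errors leave no trace in an
  expansion.\<close>

lemma has_asymp_0_if_gaussian_decay:
  assumes "f \<in> O(\<lambda>y. exp (- \<delta> * y\<^sup>2))" "\<delta> > 0"
  shows "has_asymp f 0"
proof -
  have "(\<lambda>y::real. exp (- \<delta> * y\<^sup>2)) \<in> O(\<lambda>y. (1 / y\<^sup>2) ^ N)" for N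
    using assms(2) by real_asymp
  then show ?thesis using assms(1) by (auto simp: has_asymp_def intro: landau_o.big_trans)
qed

text \<open>At the first index n where the series differ, subtracting the two truncations would make
  y^(-2n) of order y^(-2n-2).\<close>

lemma has_asymp_unique:
  assumes "has_asymp f s" "has_asymp f t"
  shows "s = t"
proof (rule ccontr)
  assume "s \<noteq> t"
  then have ex: "\<exists>n. s $ n \<noteq> t $ n" by (auto simp: fps_eq_iff)
  define n where "n = (LEAST n. s $ n \<noteq> t $ n)"
  have n: "s $ n \<noteq> t $ n" using LeastI_ex[OF ex] by (simp add: n_def)
  have less: "s $ k = t $ k" if "k < n" for k using not_less_Least that by (force simp: n_def)
  have "(\<lambda>y. (f y - (\<Sum>k<Suc n. t $ k * (1 / y\<^sup>2) ^ k)) - (f y - (\<Sum>k<Suc n. s $ k * (1 / y\<^sup>2) ^ k)))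
      \<in> O(\<lambda>y. (1 / y\<^sup>2) ^ Suc n)"
    by (rule sum_in_bigo(2)) (use assms in \<open>simp_all only: has_asymp_def\<close>)
  moreover have "(\<Sum>k<Suc n. s $ k * x ^ k) - (\<Sum>k<Suc n. t $ k * x ^ k) = (s $ n - t $ n) * x ^ n" for x
    by (simp add: less algebra_simps)
  ultimately have "(\<lambda>y. (s $ n - t $ n) * (1 / y\<^sup>2) ^ n) \<in> O(\<lambda>y. (1 / y\<^sup>2) ^ Suc n)"
    by (simp del: sum.lessThan_Suc)
  then have "(\<lambda>y::real. (1 / y\<^sup>2) ^ n) \<in> O(\<lambda>y. (1 / y\<^sup>2) ^ Suc n)"
    using n by simp
  moreover have "(\<lambda>y::real. (1 / y\<^sup>2) ^ Suc n) \<in> o(\<lambda>y. (1 / y\<^sup>2) ^ n)"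
    by real_asymp
  ultimately have "(\<lambda>y::real. (1 / y\<^sup>2) ^ n) \<in> o(\<lambda>y. (1 / y\<^sup>2) ^ n)"
    by (rule landau_o.big_small_trans)
  then have "eventually (\<lambda>y::real. (1 / y\<^sup>2) ^ n = 0) at_top"
    by (simp add: landau_o.small_refl_iff)
  moreover have "eventually (\<lambda>y::real. y > 0) at_top" by (rule eventually_gt_at_top)
  ultimately have "eventually (\<lambda>y::real. False) at_top" by eventually_elim auto
  then show False by simp
qed

section \<open>The asymptotic series of Dawson's function\<close>

lemma DERIV_inverse_power:
  "((\<lambda>y. 1 / y ^ Suc m) has_real_derivative - (real (Suc m) / y ^ Suc (Suc m))) (at y)" if "y > 0" for y :: real
proof -
  have "(y ^ m + real m * y ^ m) / (y * (y * (y ^ m * y ^ m))) = (1 + real m) / (y * (y * y ^ m))"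
    using that by (simp add: divide_simps distrib_right)
  moreover have "((\<lambda>x. 1 / (x * x ^ m)) has_real_derivative
      - ((y ^ m + real m * y ^ m) / (y * (y * (y ^ m * y ^ m))))) (at y)"
    using DERIV_inverse_fun[OF DERIV_power_Suc[OF DERIV_ident], of y m] that
    by (auto simp: field_simps)
  ultimately show ?thesis by simp
qed

text \<open>The divergent asymptotic series of a solution of Dawson's equation: with \<open>N\<close> terms, the
  truncation solves the equation up to a multiple of \<open>y ^ (- 2 * N)\<close>, and l'Hospital's rule
  compares the remainder with \<open>y ^ (- 2 * N - 1)\<close>.\<close>

lemma has_asymp_dawson:
  fixes D :: "real \<Rightarrow> real"
  assumes D: "\<And>y. (D has_real_derivative c - y * D y) (at y)"
  shows "has_asymp (\<lambda>y. y * D y) (fps_const c * dawson_fps)"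
  unfolding has_asymp_def
proof
  fix N
  define s where "s = (\<lambda>k. \<Prod>j<k. 2 * real j + 1)"
  define P where "P = (\<lambda>y. c * (\<Sum>k<N. s k * (1 / y ^ (2 * k + 1))))"
  define P' where "P' = (\<lambda>y. - c * (\<Sum>k<N. s (Suc k) * (1 / y ^ (2 * k + 2))))"
  have P: "(P has_real_derivative P' y) (at y)" if "y > 0" for y
  proof -
    have "((\<lambda>y. s k * (1 / y ^ (2 * k + 1))) has_real_derivative - (s (Suc k) * (1 / y ^ (2 * k + 2)))) (at y)" for k
    proof -
      from DERIV_cmult[OF DERIV_inverse_power[OF that], of "s k" "2 * k"] show ?thesis by (simp add: s_def ac_simps)
    qed
    then have "((\<lambda>y. \<Sum>k<N. s k * (1 / y ^ (2 * k + 1))) has_real_derivative (\<Sum>k<N. - (s (Suc k) * (1 / y ^ (2 * k + 2))))) (at y)"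
      by (intro DERIV_sum)
    from DERIV_cmult[OF this, of c] show ?thesis unfolding P_def P'_def
      by (simp add: sum_negf)
  qed
  \<comment> \<open>The coefficients of y P(y) and of P'(y) are the same up to sign and a shift by
    one index, so the sum telescopes to its first and last terms.\<close>
  have P_eq: "P' y + y * P y = c - c * s N / y ^ (2 * N)" if "y > 0" for y
  proof -
    let ?A = "\<Sum>k<N. s k * (1 / y ^ (2 * k))" and ?B = "\<Sum>k<N. s (Suc k) * (1 / y ^ (2 * Suc k))"
    have "?A - ?B = s 0 * (1 / y ^ (2 * 0)) - s N * (1 / y ^ (2 * N))"
      by (subst sum_subtractf[symmetric], subst sum_lessThan_telescope') simp
    then have e1: "?A - ?B = 1 - s N / y ^ (2 * N)" by (simp add: s_def)
    have "y * (\<Sum>k<N. s k * (1 / y ^ (2 * k + 1))) = ?A"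
      using that by (simp add: sum_distrib_left)
    then have e2: "y * P y = c * ?A" unfolding P_def by (simp only: mult.left_commute[of y c])
    have e3: "P' y = - (c * ?B)" by (simp add: P'_def)
    have "P' y + y * P y = c * ?A - c * ?B" by (simp only: e2 e3)
    also have "\<dots> = c * (1 - s N / y ^ (2 * N))" by (simp only: right_diff_distrib[symmetric] e1)
    finally show ?thesis by (simp add: right_diff_distrib)
  qed
  \<comment> \<open>exp (y^2 / 2) is the integrating factor of D' = c - y D: with it the derivative
    of \<open>f\<close> no longer contains D and can be compared explicitly with that of
    \<open>g\<close>.\<close>
  define f where "f = (\<lambda>y. exp (y\<^sup>2 / 2) * (D y - P y))"
  define g where "g = (\<lambda>y::real. exp (y\<^sup>2 / 2) / y ^ (2 * N + 1))"
  define f' where "f' = (\<lambda>y. exp (y\<^sup>2 / 2) * (c * s N / y ^ (2 * N)))"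
  define g' where "g' = (\<lambda>y::real. exp (y\<^sup>2 / 2) * (1 / y ^ (2 * N) - (2 * N + 1) / y ^ (2 * N + 2)))"
  have "((\<lambda>y. f y / g y) \<longlongrightarrow> c * s N) at_top"
  proof (rule lhospital_at_top_at_top)
    show "eventually (\<lambda>y. (f has_real_derivative f' y) (at y)) at_top"
      using eventually_gt_at_top[of 0]
    proof eventually_elim
      case (elim y)
      have "(f has_real_derivative exp (y\<^sup>2 / 2) * y * (D y - P y) + (c - y * D y - P' y) * exp (y\<^sup>2 / 2)) (at y)"
        unfolding f_def by (auto intro!: derivative_eq_intros D P[OF elim])
      moreover have "exp (y\<^sup>2 / 2) * y * (D y - P y) + (c - y * D y - P' y) * exp (y\<^sup>2 / 2) =
          exp (y\<^sup>2 / 2) * (c - (P' y + y * P y))" by (simp add: algebra_simps)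
      ultimately show ?case unfolding P_eq[OF elim] f'_def by simp
    qed
    show "eventually (\<lambda>y. (g has_real_derivative g' y) (at y)) at_top"
      using eventually_gt_at_top[of 0]
    proof eventually_elim
      case (elim y)
      have "((\<lambda>y. exp (y\<^sup>2 / 2)) has_real_derivative exp (y\<^sup>2 / 2) * y) (at y)"
        by (auto intro!: derivative_eq_intros)
      from DERIV_mult[OF this DERIV_inverse_power[OF elim, of "2 * N"]]
      have "(g has_real_derivative exp (y\<^sup>2 / 2) * y * (1 / y ^ Suc (2 * N)) +
          - (real (Suc (2 * N)) / y ^ Suc (Suc (2 * N))) * exp (y\<^sup>2 / 2)) (at y)"
        by (simp add: g_def)
      moreover have "exp (y\<^sup>2 / 2) * y * (1 / y ^ Suc (2 * N)) +
          - (real (Suc (2 * N)) / y ^ Suc (Suc (2 * N))) * exp (y\<^sup>2 / 2) = g' y"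
        using elim by (simp add: g'_def right_diff_distrib)
      ultimately show ?case by simp
    qed
    show "filterlim g at_top at_top" unfolding g_def by real_asymp
    have factor: "1 / y ^ (2 * N) - real (2 * N + 1) / y ^ (2 * N + 2) = (1 / y ^ (2 * N)) * (1 - real (2 * N + 1) / y\<^sup>2)" for y :: real
      by (simp add: right_diff_distrib power_add power2_eq_square)
    have "eventually (\<lambda>y::real. 1 - real (2 * N + 1) / y\<^sup>2 > 0) at_top" by real_asymp
    then show "eventually (\<lambda>y. g' y \<noteq> 0) at_top"
      using eventually_gt_at_top[of 0] by eventually_elim (simp only: g'_def factor, simp)
    have "((\<lambda>y::real. c * s N * (1 / (1 - real (2 * N + 1) / y\<^sup>2))) \<longlongrightarrow> c * s N * 1) at_top"
      by (intro tendsto_mult tendsto_const) real_asymp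
    then have lim: "((\<lambda>y::real. c * s N * (1 / (1 - real (2 * N + 1) / y\<^sup>2))) \<longlongrightarrow> c * s N) at_top" by simp
    have "eventually (\<lambda>y. c * s N * (1 / (1 - real (2 * N + 1) / y\<^sup>2)) = f' y / g' y) at_top"
      using eventually_gt_at_top[of 0] by eventually_elim (simp only: f'_def g'_def factor, simp)
    with lim show "((\<lambda>y. f' y / g' y) \<longlongrightarrow> c * s N) at_top" by (rule Lim_transform_eventually)
  qed
  \<comment> \<open>The odd exponent in \<open>g\<close> supplies the factor y that turns D - P into
    y D - y P; what remains is the division by (1 / y^2)^N.\<close>
  moreover have "eventually (\<lambda>y. f y / g y =
      (y * D y - (\<Sum>k<N. (fps_const c * dawson_fps) $ k * (1 / y\<^sup>2) ^ k)) / (1 / y\<^sup>2) ^ N) at_top"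
    using eventually_gt_at_top[of 0]
  proof eventually_elim
    case (elim y)
    have "(\<Sum>k<N. (fps_const c * dawson_fps) $ k * (1 / y\<^sup>2) ^ k) = y * P y"
      using elim
      by (auto simp: P_def dawson_fps_def s_def sum_distrib_left power_mult power_divide intro!: sum.cong)
    moreover have "f y / g y = (y * D y - y * P y) / (1 / y\<^sup>2) ^ N"
      using elim by (simp add: f_def g_def field_simps power_mult) (simp add: mult.commute flip: power_mult)
    ultimately show ?case by simp
  qed
  ultimately have "((\<lambda>y. (y * D y - (\<Sum>k<N. (fps_const c * dawson_fps) $ k * (1 / y\<^sup>2) ^ k)) / (1 / y\<^sup>2) ^ N)
      \<longlongrightarrow> c * s N) at_top"
    by (rule Lim_transform_eventually)
  then show "(\<lambda>y. y * D y - (\<Sum>k<N. (fps_const c * dawson_fps) $ k * (1 / y\<^sup>2) ^ k)) \<in> O(\<lambda>y. (1 / y\<^sup>2) ^ N)"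
    by (rule bigoI_tendsto) (use eventually_gt_at_top[of 0] in eventually_elim, simp)
qed

section \<open>The generating functions on the imaginary axis\<close>

text \<open>The entire integrand has an entire primitive. Once the values at 0 are matched it agrees
  with \<Phi> on the real line, where the difference has derivative zero.\<close>

lemma entire_extension_normal_cdf:
  fixes \<Phi> :: "real \<Rightarrow> real"
  assumes "\<And>x. (\<Phi> has_real_derivative k * exp (- x\<^sup>2 / 2)) (at x)"
  obtains W :: "complex \<Rightarrow> complex"
  where "\<And>z. (W has_field_derivative of_real k * exp (- z\<^sup>2 / 2)) (at z)"
    and "\<And>x. W (of_real x) = of_real (\<Phi> x)"
proof -
  let ?f = "\<lambda>z::complex. of_real k * exp (- z\<^sup>2 / 2)"
  have "?f holomorphic_on UNIV" by (intro holomorphic_intros) auto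
  then obtain g where g: "\<And>z. (g has_field_derivative ?f z) (at z)"
    using holomorphic_convex_primitive'[of UNIV ?f] by auto
  define W where "W = (\<lambda>z. g z - g 0 + of_real (\<Phi> 0))"
  have W: "(W has_field_derivative ?f z) (at z)" for z
    unfolding W_def by (auto intro!: derivative_eq_intros g)
  have "((\<lambda>x. W (of_real x) - of_real (\<Phi> x)) has_vector_derivative 0) (at x)" for x :: real
  proof -
    have "((\<lambda>x. W (of_real x)) has_vector_derivative ?f (of_real x)) (at x)"
      using field_vector_diff_chain_at[of "of_real" 1 x W "?f (of_real x)"] W
      by (auto simp: o_def has_vector_derivative_of_real[of "\<lambda>x. x" 1, simplified] intro!: derivative_eq_intros)
    moreover have "((\<lambda>x. complex_of_real (\<Phi> x)) has_vector_derivative of_real (k * exp (- x\<^sup>2 / 2))) (at x)"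
      by (rule has_vector_derivative_of_real) (rule assms)
    ultimately have "((\<lambda>x. W (of_real x) - of_real (\<Phi> x)) has_vector_derivative
        ?f (of_real x) - of_real (k * exp (- x\<^sup>2 / 2))) (at x)"
      by (rule has_vector_derivative_diff)
    moreover have "?f (of_real x) = of_real (k * exp (- x\<^sup>2 / 2))"
      by (simp add: exp_of_real[symmetric])
    ultimately show ?thesis by (simp only: diff_self)
  qed
  then have "W (of_real x) - of_real (\<Phi> x) = W (of_real 0) - of_real (\<Phi> 0)" for x :: real
    using has_vector_derivative_zero_constant[of UNIV "\<lambda>x. W (of_real x) - of_real (\<Phi> x)"] by (metis UNIV_I convex_UNIV)
  then have "W (of_real x) = of_real (\<Phi> x)" for x by (simp add: W_def)
  with W show ?thesis by (rule that)
qed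

lemma has_asymp_dawson_factor:
  fixes D :: "real \<Rightarrow> real"
  assumes D: "\<And>y. (D has_real_derivative k - y * D y) (at y)" and "D 0 = 0" and odd: "\<And>y. D (- y) = - D y"
  shows "has_asymp (\<lambda>y. q * exp (- (l * y)\<^sup>2) + (D (l * y))\<^sup>2) (dawson_factor q (k\<^sup>2) l)"
proof (cases "l = 0")
  case True
  then show ?thesis using has_asymp_const[of q] assms(2) by (simp add: dawson_factor_def)
next
  case False
  have "has_asymp (\<lambda>y. 1 / y\<^sup>2 * ((y * D y) * (y * D y))) (fps_X * ((fps_const k * dawson_fps) * (fps_const k * dawson_fps)))"
    by (intro has_asymp_mult has_asymp_inverse_square has_asymp_dawson D)
  then have "has_asymp (\<lambda>y. (D y)\<^sup>2) (fps_X * ((fps_const k * dawson_fps) * (fps_const k * dawson_fps)))"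
    by (rule has_asymp_cong) (use eventually_gt_at_top[of 0] in eventually_elim, simp add: power2_eq_square)
  moreover have "fps_X * ((fps_const k * dawson_fps) * (fps_const k * dawson_fps)) =
      (fps_const k * fps_const k) * (fps_X * (dawson_fps * dawson_fps))" by (simp only: mult_ac)
  ultimately have "has_asymp (\<lambda>y. (D y)\<^sup>2) (fps_const (k\<^sup>2) * (fps_X * (dawson_fps * dawson_fps)))"
    by (simp add: power2_eq_square)
  moreover have "has_asymp (\<lambda>y. q * exp (- y\<^sup>2)) 0"
    by (rule has_asymp_0_if_gaussian_decay[of _ 1]) (cases "q = 0", auto)
  ultimately have "has_asymp (\<lambda>y. q * exp (- y\<^sup>2) + (D y)\<^sup>2) (0 + fps_const (k\<^sup>2) * (fps_X * (dawson_fps * dawson_fps)))"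
    by (rule has_asymp_add[rotated])
  \<comment> \<open>Rescaling asks for a positive factor, hence the absolute value of l; as D is
    odd, its square does not see the sign.\<close>
  from has_asymp_scale[OF this, of "\<bar>l\<bar>"] False
  have "has_asymp (\<lambda>y. q * exp (- (\<bar>l\<bar> * y)\<^sup>2) + (D (\<bar>l\<bar> * y))\<^sup>2) (dawson_factor q (k\<^sup>2) l)"
    by (simp add: dawson_factor_def)
  moreover have "(D (\<bar>l\<bar> * y))\<^sup>2 = (D (l * y))\<^sup>2" for y
    using odd[of "l * y"] by (simp add: abs_if)
  ultimately show ?thesis by (simp add: power_mult_distrib)
qed

text \<open>Multiplication by exp (y^2 a) leaves the positive rates b - a and c - a on the right. It
  serves to exclude a Gaussian rate that is strictly smaller than both others.\<close>

lemma gaussian_domination_decay: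
  fixes U V W :: "real \<Rightarrow> real"
  assumes le: "\<And>y. exp (- (y\<^sup>2 * a)) * U y \<le> K * (exp (- (y\<^sup>2 * b)) * V y) + L * (exp (- (y\<^sup>2 * c)) * W y)"
    and U: "\<And>y. U y \<ge> 0" and V: "V \<in> O(\<lambda>_. 1)" and W: "W \<in> O(\<lambda>_. 1)" and ab: "a < b" and ac: "a < c"
  obtains \<delta> where "\<delta> > 0" "U \<in> O(\<lambda>y. exp (- \<delta> * y\<^sup>2))"
proof
  define \<delta> where "\<delta> = min (b - a) (c - a)"
  show "\<delta> > 0" using ab ac by (simp add: \<delta>_def)
  have small: "(\<lambda>y. M * (exp (- (y\<^sup>2 * (d - a))) * X y)) \<in> O(\<lambda>y. exp (- \<delta> * y\<^sup>2))"
    if "X \<in> O(\<lambda>_. 1)" "\<delta> \<le> d - a" for M d and X :: "real \<Rightarrow> real"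
  proof -
    have "(\<lambda>y. exp (- (y\<^sup>2 * (d - a)))) \<in> O(\<lambda>y. exp (- \<delta> * y\<^sup>2))"
    proof (intro bigoI[of _ 1] always_eventually allI)
      fix y :: real
      have "y\<^sup>2 * \<delta> \<le> y\<^sup>2 * (d - a)" using that by (intro mult_left_mono) auto
      then show "norm (exp (- (y\<^sup>2 * (d - a)))) \<le> 1 * norm (exp (- \<delta> * y\<^sup>2))" by (simp add: mult.commute)
    qed
    from landau_o.big.mult[OF this that(1)] show ?thesis by (cases "M = 0") auto
  qed
  have "(\<lambda>y. K * (exp (- (y\<^sup>2 * (b - a))) * V y) + L * (exp (- (y\<^sup>2 * (c - a))) * W y)) \<in> O(\<lambda>y. exp (- \<delta> * y\<^sup>2))"
    by (intro sum_in_bigo(1) small V W) (simp_all add: \<delta>_def)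
  moreover have "norm (U y) \<le> norm (K * (exp (- (y\<^sup>2 * (b - a))) * V y) + L * (exp (- (y\<^sup>2 * (c - a))) * W y))" for y
  proof -
    have "exp (y\<^sup>2 * a) * (exp (- (y\<^sup>2 * a)) * U y) \<le> exp (y\<^sup>2 * a) * (K * (exp (- (y\<^sup>2 * b)) * V y) + L * (exp (- (y\<^sup>2 * c)) * W y))"
      by (intro mult_left_mono le) simp
    then have "U y \<le> K * (exp (- (y\<^sup>2 * (b - a))) * V y) + L * (exp (- (y\<^sup>2 * (c - a))) * W y)"
      by (simp add: algebra_simps flip: exp_add mult.assoc)
    with U[of y] show ?thesis by simp
  qed
  then have "U \<in> O(\<lambda>y. K * (exp (- (y\<^sup>2 * (b - a))) * V y) + L * (exp (- (y\<^sup>2 * (c - a))) * W y))"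
    by (intro bigoI[of _ 1] always_eventually allI) (simp only: mult_1)
  ultimately show "U \<in> O(\<lambda>y. exp (- \<delta> * y\<^sup>2))"
    by (rule landau_o.big_trans[rotated])
qed

text \<open>The problem restricted to a line s t. In the application \<open>m\<close>,
  \<open>\<gamma>\<close> and \<open>l i\<close> are t' \<mu>, t' \<Gamma> t and t' times the
  columns of \<Lambda>, so that \<gamma> plus the sum of squares is t' \<Omega> t.\<close>

lemma line_rigidity:
  fixes \<Phi> :: "real \<Rightarrow> real" and l l1 l0 :: "'n::finite \<Rightarrow> real"
  assumes \<Phi>: "\<And>x. (\<Phi> has_real_derivative k * exp (- x\<^sup>2 / 2)) (at x)" and "k > 0" and "\<Phi> 0 > 0"
    and c: "0 < c" "c < 1"
    and eq: "\<And>s. exp (s * m + s\<^sup>2 * (\<gamma> + (\<Sum>i\<in>UNIV. (l i)\<^sup>2)) / 2) * (\<Prod>i\<in>UNIV. \<Phi> (s * l i)) =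
        c * (exp (s * m1 + s\<^sup>2 * (\<gamma>1 + (\<Sum>i\<in>UNIV. (l1 i)\<^sup>2)) / 2) * (\<Prod>i\<in>UNIV. \<Phi> (s * l1 i))) +
        (1 - c) * (exp (s * m0 + s\<^sup>2 * (\<gamma>0 + (\<Sum>i\<in>UNIV. (l0 i)\<^sup>2)) / 2) * (\<Prod>i\<in>UNIV. \<Phi> (s * l0 i)))"
  shows "\<gamma> = \<gamma>1 \<or> \<gamma>0 = \<gamma>1"
proof (rule ccontr)
  assume "\<not> ?thesis"
  then have ne: "\<gamma> \<noteq> \<gamma>1" "\<gamma>0 \<noteq> \<gamma>1" by auto
  obtain W :: "complex \<Rightarrow> complex" where W: "\<And>z. (W has_field_derivative of_real k * exp (- z\<^sup>2 / 2)) (at z)"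
    and W_real: "\<And>x. W (of_real x) = of_real (\<Phi> x)"
    using entire_extension_normal_cdf[OF \<Phi>] by blast
  define F where "F = (\<lambda>m \<gamma> (l :: 'n \<Rightarrow> real) z. exp (z * of_real m + z\<^sup>2 * of_real (\<gamma> + (\<Sum>i\<in>UNIV. (l i)\<^sup>2)) / 2) *
      (\<Prod>i\<in>UNIV. W (z * of_real (l i))))"
  have W_hol: "W holomorphic_on UNIV"
    using W by (auto simp: holomorphic_on_def field_differentiable_def intro: has_field_derivative_at_within)
  have F_hol: "F m \<gamma> l holomorphic_on UNIV" for m \<gamma> l
  proof -
    have "(\<lambda>z. W (z * of_real a)) holomorphic_on UNIV" for a
      by (rule holomorphic_on_compose_gen[OF _ W_hol, unfolded o_def]) (auto intro!: holomorphic_intros)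
    then show ?thesis unfolding F_def by (intro holomorphic_intros) auto
  qed
  have F_real: "F m \<gamma> l (of_real s) =
      of_real (exp (s * m + s\<^sup>2 * (\<gamma> + (\<Sum>i\<in>UNIV. (l i)\<^sup>2)) / 2) * (\<Prod>i\<in>UNIV. \<Phi> (s * l i)))" for m \<gamma> l s
    unfolding F_def by (simp add: exp_of_real[symmetric] W_real[symmetric])
  have F_eq: "F m \<gamma> l z = of_real c * F m1 \<gamma>1 l1 z + of_real (1 - c) * F m0 \<gamma>0 l0 z" for z
  proof -
    \<comment> \<open>Both sides are entire and agree on the real axis, which accumulates at
      0.\<close>
    have "F m \<gamma> l z - (of_real c * F m1 \<gamma>1 l1 z + of_real (1 - c) * F m0 \<gamma>0 l0 z) = 0"
    proof (rule analytic_continuation[where S = UNIV and U = "range of_real" and \<xi> = 0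
          and f = "\<lambda>z. F m \<gamma> l z - (of_real c * F m1 \<gamma>1 l1 z + of_real (1 - c) * F m0 \<gamma>0 l0 z)"])
      show "(\<lambda>z. F m \<gamma> l z - (of_real c * F m1 \<gamma>1 l1 z + of_real (1 - c) * F m0 \<gamma>0 l0 z)) holomorphic_on UNIV"
        by (intro holomorphic_intros F_hol)
      show "(0::complex) islimpt range of_real"
      proof (rule islimpt_sequential[THEN iffD2], intro exI conjI allI)
        show "complex_of_real (1 / real (Suc n)) \<in> range of_real - {0}" for n
          by (intro DiffI rangeI) (simp only: singleton_iff of_real_eq_0_iff, simp)
        have "(\<lambda>n. 1 / real (Suc n)) \<longlonglongrightarrow> 0"
          by (rule LIMSEQ_Suc) (rule lim_1_over_n)
        then have "(\<lambda>n. complex_of_real (1 / real (Suc n))) \<longlonglongrightarrow> of_real 0"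
          by (rule tendsto_of_real)
        then show "(\<lambda>n. complex_of_real (1 / real (Suc n))) \<longlonglongrightarrow> 0" by (simp only: of_real_0)
      qed
      show "F m \<gamma> l w - (of_real c * F m1 \<gamma>1 l1 w + of_real (1 - c) * F m0 \<gamma>0 l0 w) = 0"
        if "w \<in> range of_real" for w
      proof -
        from that obtain s where w: "w = of_real s" by blast
        show ?thesis unfolding w F_real eq[of s] by simp
      qed
    qed auto
    then show ?thesis by simp
  qed
  \<comment> \<open>W(i y) = \<Phi>(0) + i J(y), since the derivative along the imaginary axis is i
    times a real number. Weighting J by the Gaussian gives a solution of D' = k - y D, Dawson's
    function up to normalisation.\<close>
  define J where "J = (\<lambda>y. Im (W (\<i> * of_real y)))"
  define D where "D = (\<lambda>y. exp (- y\<^sup>2 / 2) * J y)"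
  define q where "q = (\<Phi> 0)\<^sup>2"
  have W_imag: "((\<lambda>y. W (\<i> * of_real y)) has_vector_derivative \<i> * of_real (k * exp (y\<^sup>2 / 2))) (at y)" for y
  proof -
    have "((\<lambda>y. \<i> * complex_of_real y) has_vector_derivative \<i>) (at y)"
      by (auto intro!: derivative_eq_intros)
    from field_vector_diff_chain_at[OF this W]
    have "((\<lambda>y. W (\<i> * of_real y)) has_vector_derivative \<i> * (of_real k * exp (- (\<i> * of_real y)\<^sup>2 / 2))) (at y)"
      by (simp add: o_def)
    moreover have "of_real k * exp (- (\<i> * of_real y)\<^sup>2 / 2) = complex_of_real (k * exp (y\<^sup>2 / 2))"
      by (simp add: exp_of_real[symmetric] power_mult_distrib)
    ultimately show ?thesis by (simp only:)
  qed
  have J: "(J has_real_derivative k * exp (y\<^sup>2 / 2)) (at y)" for y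
    unfolding J_def has_real_derivative_iff_has_vector_derivative
    using bounded_linear.has_vector_derivative[OF bounded_linear_Im W_imag[of y]] by simp
  have J0: "J 0 = 0" using W_real[of 0] by (simp add: J_def)
  have Re: "Re (W (\<i> * of_real y)) = \<Phi> 0" for y
  proof -
    have "((\<lambda>y. Re (W (\<i> * of_real y))) has_vector_derivative 0) (at y)" for y
      using bounded_linear.has_vector_derivative[OF bounded_linear_Re W_imag[of y]] by simp
    then have "Re (W (\<i> * of_real y)) = Re (W (\<i> * of_real 0))"
      using has_vector_derivative_zero_constant[of UNIV "\<lambda>y. Re (W (\<i> * of_real y))"] by (metis UNIV_I convex_UNIV)
    then show ?thesis using W_real[of 0] by simp
  qed
  have J_odd: "J (- y) = - J y" for y
  proof -
    have "((\<lambda>y. J y + J (- y)) has_real_derivative 0) (at y)" for y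
    proof -
      have "((\<lambda>y. J (- y)) has_real_derivative k * exp ((- y)\<^sup>2 / 2) * (- 1)) (at y)"
        by (rule DERIV_chain2[OF J]) (auto intro!: derivative_eq_intros)
      from DERIV_add[OF J this] show ?thesis by simp
    qed
    then have "J y + J (- y) = J 0 + J (- 0)"
      by (intro DERIV_isconst_all) auto
    then show ?thesis using J0 by simp
  qed
  have D: "(D has_real_derivative k - y * D y) (at y)" for y
    unfolding D_def by (auto intro!: derivative_eq_intros J simp: exp_minus field_simps)
  have D_0: "D 0 = 0" and D_odd: "D (- y) = - D y" for y
    by (simp_all add: D_def J0 J_odd)
  \<comment> \<open>The squared modulus without its factor exp (- y^2 \<gamma>). The quadratic
    exponent also contributes exp (- (l i y)^2) for each i; merged with the squared modulus q + J(l
    i y)^2, it turns J into D.\<close>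
  define V where "V = (\<lambda>(l :: 'n \<Rightarrow> real) y. \<Prod>i\<in>UNIV. (q * exp (- (l i * y)\<^sup>2) + (D (l i * y))\<^sup>2))"
  define P where "P = (\<lambda>l :: 'n \<Rightarrow> real. \<Prod>i\<in>UNIV. dawson_factor q (k\<^sup>2) (l i))"
  have q: "q > 0" using \<open>\<Phi> 0 > 0\<close> by (simp add: q_def)
  have V: "has_asymp (V l) (P l)" for l
    unfolding V_def P_def by (intro has_asymp_prod has_asymp_dawson_factor D D_0 D_odd) auto
  have V_nonneg: "V l y \<ge> 0" for l y
    unfolding V_def using q by (intro prod_nonneg) auto
  have V_bounded: "V l \<in> O(\<lambda>_. 1)" for l using has_asymp_bounded[OF V] .
  have P: "P l \<noteq> 0" for l
    unfolding P_def by (rule prod_dawson_factor_nonzero) (use q \<open>k > 0\<close> in auto)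
  have norm_F: "(norm (F m \<gamma> l (\<i> * of_real y)))\<^sup>2 = exp (- (y\<^sup>2 * \<gamma>)) * V l y" for m \<gamma> l y
  proof -
    have *: "norm (exp (\<i> * of_real y * of_real m + (\<i> * of_real y)\<^sup>2 * of_real (\<gamma> + (\<Sum>i\<in>UNIV. (l i)\<^sup>2)) / 2))
        = exp (- (y\<^sup>2 * (\<gamma> + (\<Sum>i\<in>UNIV. (l i)\<^sup>2)) / 2))"
      by (simp add: norm_exp_eq_Re power_mult_distrib)
    have 1: "(norm (exp (\<i> * of_real y * of_real m + (\<i> * of_real y)\<^sup>2 * of_real (\<gamma> + (\<Sum>i\<in>UNIV. (l i)\<^sup>2)) / 2)))\<^sup>2
        = exp (- (y\<^sup>2 * \<gamma>)) * (\<Prod>i\<in>UNIV. exp (- (l i * y)\<^sup>2))"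
    proof -
      have "(\<Prod>i\<in>UNIV. exp (- (l i * y)\<^sup>2)) = exp (- (y\<^sup>2 * (\<Sum>i\<in>UNIV. (l i)\<^sup>2)))"
        by (simp add: exp_sum[symmetric] power_mult_distrib sum_distrib_left sum_negf mult.commute)
      then have "exp (- (y\<^sup>2 * \<gamma>)) * (\<Prod>i\<in>UNIV. exp (- (l i * y)\<^sup>2)) = exp (2 * - (y\<^sup>2 * (\<gamma> + (\<Sum>i\<in>UNIV. (l i)\<^sup>2)) / 2))"
        by (simp add: exp_add[symmetric] distrib_left add_divide_distrib)
      then show ?thesis by (simp only: * exp_double)
    qed
    have 2: "(norm (W (\<i> * of_real y * of_real a)))\<^sup>2 = q + (J (a * y))\<^sup>2" for a
    proof -
      have "\<i> * of_real y * of_real a = \<i> * of_real (a * y)" by simp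
      then show ?thesis by (simp only: cmod_power2 q_def J_def Re)
    qed
    have 3: "exp (- (a * y)\<^sup>2) * (q + (J (a * y))\<^sup>2) = q * exp (- (a * y)\<^sup>2) + (D (a * y))\<^sup>2" for a
      by (simp add: D_def power_mult_distrib exp_double[symmetric] algebra_simps)
    have "(norm (F m \<gamma> l (\<i> * of_real y)))\<^sup>2 = exp (- (y\<^sup>2 * \<gamma>)) * (\<Prod>i\<in>UNIV. exp (- (l i * y)\<^sup>2)) *
        (\<Prod>i\<in>UNIV. q + (J (l i * y))\<^sup>2)"
    proof -
      have "(norm (\<Prod>i\<in>UNIV. W (\<i> * of_real y * of_real (l i))))\<^sup>2 = (\<Prod>i\<in>UNIV. q + (J (l i * y))\<^sup>2)"
        by (simp only: prod_norm[symmetric] prod_power_distrib 2)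
      moreover have "(norm (u * v))\<^sup>2 = (norm u)\<^sup>2 * (norm v)\<^sup>2" for u v :: complex
        by (simp add: norm_mult power_mult_distrib)
      ultimately show ?thesis by (simp only: F_def 1)
    qed
    then show ?thesis
      by (simp add: V_def 3[symmetric] prod.distrib mult.assoc)
  qed
  \<comment> \<open>The expansions concern squared moduli, so the triangle inequality is squared at
    the price of a factor 2.\<close>
  have square_le: "x\<^sup>2 \<le> 2 * K\<^sup>2 * y\<^sup>2 + 2 * L\<^sup>2 * z\<^sup>2" if "0 \<le> x" "x \<le> K * y + L * z" for x y z K L :: real
  proof -
    have "x\<^sup>2 \<le> (K * y + L * z)\<^sup>2" using that by (intro power_mono) auto
    also have "\<dots> \<le> 2 * K\<^sup>2 * y\<^sup>2 + 2 * L\<^sup>2 * z\<^sup>2"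
      using zero_le_power2[of "K * y - L * z"] by (simp add: power2_sum power2_diff power_mult_distrib)
    finally show ?thesis .
  qed
  \<comment> \<open>A rate strictly below the other two would make \<open>V l\<close> decay like a
    Gaussian, so that its expansion would be 0, yet it is \<open>P l\<close>, which is
    nonzero.\<close>
  have min_attained_twice: False
    if le: "\<And>y. norm (F m \<gamma> l (\<i> * of_real y)) \<le>
        K * norm (F m' \<gamma>' l' (\<i> * of_real y)) + L * norm (F m'' \<gamma>'' l'' (\<i> * of_real y))"
      and less: "\<gamma> < \<gamma>'" "\<gamma> < \<gamma>''" for m \<gamma> l m' \<gamma>' l' m'' \<gamma>'' l'' K L
  proof -
    have "exp (- (y\<^sup>2 * \<gamma>)) * V l y \<le>
        2 * K\<^sup>2 * (exp (- (y\<^sup>2 * \<gamma>')) * V l' y) + 2 * L\<^sup>2 * (exp (- (y\<^sup>2 * \<gamma>'')) * V l'' y)" for y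
      using square_le[OF norm_ge_zero le[of y]] by (simp only: norm_F)
    from gaussian_domination_decay[OF this V_nonneg V_bounded V_bounded less]
    have "has_asymp (V l) 0" by (metis has_asymp_0_if_gaussian_decay)
    with V[of l] P[of l] show False using has_asymp_unique by blast
  qed
  define Ng where "Ng = (\<lambda>y. norm (F m \<gamma> l (\<i> * complex_of_real y)))"
  define N1 where "N1 = (\<lambda>y. norm (F m1 \<gamma>1 l1 (\<i> * complex_of_real y)))"
  define N0 where "N0 = (\<lambda>y. norm (F m0 \<gamma>0 l0 (\<i> * complex_of_real y)))"
  have le_g: "Ng y \<le> c * N1 y + (1 - c) * N0 y" and le_1: "c * N1 y \<le> Ng y + (1 - c) * N0 y"
    and le_0: "(1 - c) * N0 y \<le> Ng y + c * N1 y" for y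
  proof -
    let ?z = "\<i> * complex_of_real y"
    have n: "norm (of_real c * F m1 \<gamma>1 l1 ?z) = c * N1 y" "norm (of_real (1 - c) * F m0 \<gamma>0 l0 ?z) = (1 - c) * N0 y"
      using c by (simp_all add: norm_mult N1_def N0_def del: of_real_diff)
    show "Ng y \<le> c * N1 y + (1 - c) * N0 y"
      unfolding n[symmetric] Ng_def F_eq[of ?z] by (rule norm_triangle_ineq)
    have "of_real c * F m1 \<gamma>1 l1 ?z = F m \<gamma> l ?z - of_real (1 - c) * F m0 \<gamma>0 l0 ?z"
      by (simp only: F_eq[of ?z]) simp
    then show "c * N1 y \<le> Ng y + (1 - c) * N0 y"
      unfolding n[symmetric] Ng_def by (simp only: norm_triangle_ineq4)
    have "of_real (1 - c) * F m0 \<gamma>0 l0 ?z = F m \<gamma> l ?z - of_real c * F m1 \<gamma>1 l1 ?z"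
      by (simp only: F_eq[of ?z]) simp
    then show "(1 - c) * N0 y \<le> Ng y + c * N1 y"
      unfolding n[symmetric] Ng_def by (simp only: norm_triangle_ineq4)
  qed
  \<comment> \<open>The three triangle inequalities bound each modulus by the other two, so no rate
    is a strict minimum. As \<gamma> and \<gamma>0 both differ from \<gamma>1, the minimum is
    attained exactly at \<gamma> and \<gamma>0.\<close>
  have "\<not> (\<gamma> < \<gamma>1 \<and> \<gamma> < \<gamma>0)"
    using min_attained_twice[of m \<gamma> l c m1 \<gamma>1 l1 "1 - c" m0 \<gamma>0 l0] le_g by (auto simp: Ng_def N1_def N0_def)
  moreover have "\<not> (\<gamma>1 < \<gamma> \<and> \<gamma>1 < \<gamma>0)"
  proof -
    have "N1 y \<le> (1 / c) * Ng y + ((1 - c) / c) * N0 y" for y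
      using le_1[of y] c by (simp add: field_simps)
    then show ?thesis
      using min_attained_twice[of m1 \<gamma>1 l1 "1 / c" m \<gamma> l "(1 - c) / c" m0 \<gamma>0 l0] by (auto simp: Ng_def N1_def N0_def)
  qed
  moreover have "\<not> (\<gamma>0 < \<gamma> \<and> \<gamma>0 < \<gamma>1)"
  proof -
    have "N0 y \<le> (1 / (1 - c)) * Ng y + (c / (1 - c)) * N1 y" for y
    proof -
      have "N0 y \<le> (Ng y + c * N1 y) / (1 - c)"
        using le_0[of y] c by (simp add: pos_le_divide_eq mult.commute)
      then show ?thesis by (simp add: add_divide_distrib)
    qed
    then show ?thesis
      using min_attained_twice[of m0 \<gamma>0 l0 "1 / (1 - c)" m \<gamma> l "c / (1 - c)" m1 \<gamma>1 l1] by (auto simp: Ng_def N1_def N0_def)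
  qed
  ultimately have \<gamma>: "\<gamma>0 = \<gamma>" "\<gamma> < \<gamma>1" using ne by linarith+
  \<comment> \<open>From here the constant 1 - c must survive exactly, so the inequality between the
    moduli is kept unsquared. Hence the square roots, and half of the gap between the rates in
    \<open>\<delta>\<close>.\<close>
  define Bg where "Bg = (\<lambda>y. sqrt (V l y))"
  define B1 where "B1 = (\<lambda>y. sqrt (V l1 y))"
  define B0 where "B0 = (\<lambda>y. sqrt (V l0 y))"
  have sqrt_bounded: "(\<lambda>y. sqrt (V l y)) \<in> O(\<lambda>_. 1)" for l
  proof -
    obtain C where "eventually (\<lambda>y. norm (V l y) \<le> C * norm (1::real)) at_top"
      using V_bounded[of l] by (elim landau_o.bigE)
    then have "eventually (\<lambda>y. norm (sqrt (V l y)) \<le> sqrt C * norm (1::real)) at_top"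
      by eventually_elim (use V_nonneg in auto)
    then show ?thesis by (rule bigoI)
  qed
  have N: "Ng y = exp (- (y\<^sup>2 * \<gamma> / 2)) * Bg y" "N1 y = exp (- (y\<^sup>2 * \<gamma>1 / 2)) * B1 y"
    "N0 y = exp (- (y\<^sup>2 * \<gamma> / 2)) * B0 y" for y
  proof -
    have "norm (F m \<gamma> l (\<i> * of_real y)) = exp (- (y\<^sup>2 * \<gamma> / 2)) * sqrt (V l y)" for m \<gamma> l
    proof -
      have "(exp (- (y\<^sup>2 * \<gamma> / 2)) * sqrt (V l y))\<^sup>2 = exp (- (y\<^sup>2 * \<gamma>)) * V l y"
        using V_nonneg by (simp add: power_mult_distrib exp_double[symmetric])
      then show ?thesis using norm_F[of m \<gamma> l y] V_nonneg
        by (metis (no_types, lifting) norm_ge_zero power2_eq_imp_eq mult_nonneg_nonneg exp_ge_zero real_sqrt_ge_zero)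
    qed
    then show "Ng y = exp (- (y\<^sup>2 * \<gamma> / 2)) * Bg y" "N1 y = exp (- (y\<^sup>2 * \<gamma>1 / 2)) * B1 y"
      "N0 y = exp (- (y\<^sup>2 * \<gamma> / 2)) * B0 y"
      by (simp_all add: Ng_def N1_def N0_def Bg_def B1_def B0_def \<gamma>)
  qed
  define \<delta> where "\<delta> = (\<gamma>1 - \<gamma>) / 2"
  have \<delta>: "\<delta> > 0" using \<gamma> by (simp add: \<delta>_def)
  have diff: "\<bar>Bg y - (1 - c) * B0 y\<bar> \<le> exp (- \<delta> * y\<^sup>2) * B1 y" for y
  proof -
    have B1: "B1 y \<ge> 0" by (simp add: B1_def V_nonneg)
    have e: "exp (- (y\<^sup>2 * \<gamma>1 / 2)) = exp (- (y\<^sup>2 * \<gamma> / 2)) * exp (- \<delta> * y\<^sup>2)"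
      by (simp add: exp_add[symmetric] \<delta>_def algebra_simps add_divide_distrib[symmetric] diff_divide_distrib)
    have "\<bar>Ng y - (1 - c) * N0 y\<bar> \<le> c * N1 y"
      using le_g[of y] le_0[of y] by linarith
    then have "exp (- (y\<^sup>2 * \<gamma> / 2)) * \<bar>Bg y - (1 - c) * B0 y\<bar> \<le> exp (- (y\<^sup>2 * \<gamma> / 2)) * (c * (exp (- \<delta> * y\<^sup>2) * B1 y))"
    proof -
      have "Ng y - (1 - c) * N0 y = exp (- (y\<^sup>2 * \<gamma> / 2)) * (Bg y - (1 - c) * B0 y)"
        by (simp add: N algebra_simps)
      then have "\<bar>Ng y - (1 - c) * N0 y\<bar> = exp (- (y\<^sup>2 * \<gamma> / 2)) * \<bar>Bg y - (1 - c) * B0 y\<bar>"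
        by (simp only: abs_mult abs_exp_cancel)
      moreover have "c * N1 y = exp (- (y\<^sup>2 * \<gamma> / 2)) * (c * (exp (- \<delta> * y\<^sup>2) * B1 y))"
        unfolding N e by (simp only: mult_ac)
      ultimately show ?thesis using \<open>\<bar>Ng y - (1 - c) * N0 y\<bar> \<le> c * N1 y\<close> by (simp only:)
    qed
    then have "\<bar>Bg y - (1 - c) * B0 y\<bar> \<le> c * (exp (- \<delta> * y\<^sup>2) * B1 y)" by simp
    also have "\<dots> \<le> 1 * (exp (- \<delta> * y\<^sup>2) * B1 y)"
      using c B1 by (intro mult_right_mono) auto
    finally show ?thesis by simp
  qed
  have "(\<lambda>y. exp (- \<delta> * y\<^sup>2) * B1 y) \<in> O(\<lambda>y. exp (- \<delta> * y\<^sup>2) * 1)"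
    unfolding B1_def by (intro landau_o.big.mult sqrt_bounded) simp
  moreover have "(\<lambda>y. Bg y - (1 - c) * B0 y) \<in> O(\<lambda>y. exp (- \<delta> * y\<^sup>2) * B1 y)"
    by (intro bigoI[of _ 1] always_eventually allI) (use diff V_nonneg in \<open>auto simp: B1_def intro: order_trans\<close>)
  ultimately have "(\<lambda>y. Bg y - (1 - c) * B0 y) \<in> O(\<lambda>y. exp (- \<delta> * y\<^sup>2) * 1)"
    by (rule landau_o.big_trans[rotated])
  moreover have "(\<lambda>y. Bg y + (1 - c) * B0 y) \<in> O(\<lambda>_. 1)"
    using sqrt_bounded[of l] sqrt_bounded[of l0] c unfolding Bg_def B0_def by (intro sum_in_bigo(1)) simp_all
  \<comment> \<open>Multiplying the exponentially small difference by the bounded sum leads back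
    from the square roots to V, which has an expansion.\<close>
  ultimately have "(\<lambda>y. (Bg y - (1 - c) * B0 y) * (Bg y + (1 - c) * B0 y)) \<in> O(\<lambda>y. (exp (- \<delta> * y\<^sup>2) * 1) * 1)"
    by (rule landau_o.big.mult)
  moreover have "(Bg y - (1 - c) * B0 y) * (Bg y + (1 - c) * B0 y) = V l y + - (1 - c)\<^sup>2 * V l0 y" for y
  proof -
    have "(Bg y)\<^sup>2 = V l y" "(B0 y)\<^sup>2 = V l0 y" by (simp_all add: Bg_def B0_def V_nonneg)
    then show ?thesis by (auto simp: power2_eq_square algebra_simps)
  qed
  ultimately have "has_asymp (\<lambda>y. V l y + - (1 - c)\<^sup>2 * V l0 y) 0"
    using has_asymp_0_if_gaussian_decay[OF _ \<delta>] by simp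
  moreover have "has_asymp (\<lambda>y. V l y + - (1 - c)\<^sup>2 * V l0 y) (P l + fps_const (- (1 - c)\<^sup>2) * P l0)"
    by (intro has_asymp_add has_asymp_mult has_asymp_const V)
  ultimately have "P l + fps_const (- (1 - c)\<^sup>2) * P l0 = 0"
    using has_asymp_unique by blast
  then have "P l = fps_const ((1 - c)\<^sup>2) * P l0"
    by (simp add: fps_const_neg[symmetric] del: fps_const_neg)
  then have "(1 - c)\<^sup>2 = 1"
    unfolding P_def using c q \<open>k > 0\<close>
    by (intro dawson_factor_prod_rigid[of UNIV UNIV q "k\<^sup>2" "(1 - c)\<^sup>2" l l0]) auto
  then show False using c by (simp add: power2_eq_1_iff)
qed

unbundle no fps_syntax
unbundle vec_syntax

section \<open>Lebesgue measure under linear maps\<close>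

lemma Basis_real_vec: "(Basis :: (real ^ 'n) set) = range (\<lambda>k. axis k 1)"
  by (auto simp: Basis_vec_def)

lemma inj_axis_1: "inj (\<lambda>k::'n::finite. axis k (1::real))"
  by (auto simp: inj_on_def axis_eq_axis)

lemma nn_integral_lborel_translate:
  fixes g :: "'a::euclidean_space \<Rightarrow> ennreal"
  assumes [measurable]: "g \<in> borel_measurable borel"
  shows "(\<integral>\<^sup>+x. g (c + x) \<partial>lborel) = (\<integral>\<^sup>+x. g x \<partial>lborel)"
proof -
  have "(\<integral>\<^sup>+x. g x \<partial>lborel) = (\<integral>\<^sup>+x. g x \<partial>distr lborel borel ((+) c))"
    by (simp only: lborel_distr_plus)
  also have "\<dots> = (\<integral>\<^sup>+x. g (c + x) \<partial>lborel)"
    by (rule nn_integral_distr) simp_all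
  finally show ?thesis by simp
qed

text \<open>Uniqueness of Haar measure: integrate \<open>g (f x) * indicator B (y - f x)\<close> over \<open>x\<close> and \<open>y\<close>
  in both orders.\<close>

lemma nn_integral_lborel_linear_bij_scale:
  fixes f :: "'a::euclidean_space \<Rightarrow> 'a"
  assumes f: "linear f" "bij f"
  obtains c :: real where "c > 0"
    and "\<And>g. g \<in> borel_measurable borel \<Longrightarrow> (\<integral>\<^sup>+x. g (f x) \<partial>lborel) = ennreal c * (\<integral>\<^sup>+x. g x \<partial>lborel)"
proof -
  define B where "B = ball (0::'a) 1"
  define K where "K = (\<integral>\<^sup>+x. indicator B (- f x) \<partial>lborel)"
  define b where "b = measure lborel B"
  have b: "emeasure lborel B = ennreal b"
    unfolding b_def B_def by (rule emeasure_eq_ennreal_measure) (use emeasure_lborel_ball_finite in \<open>simp add: less_top\<close>)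
  have "b > 0"
    unfolding b_def B_def using content_ball_pos[of 1 0] by simp
  have [measurable]: "f \<in> borel_measurable borel" "B \<in> sets borel"
    using f by (auto simp: B_def intro!: borel_measurable_continuous_onI linear_continuous_on linear_conv_bounded_linear[THEN iffD1])
  have main: "ennreal b * (\<integral>\<^sup>+x. g (f x) \<partial>lborel) = K * (\<integral>\<^sup>+x. g x \<partial>lborel)"
    if [measurable]: "g \<in> borel_measurable borel" for g :: "'a \<Rightarrow> ennreal"
  proof -
    have "ennreal b * (\<integral>\<^sup>+x. g (f x) \<partial>lborel) = (\<integral>\<^sup>+x. g (f x) * ennreal b \<partial>lborel)"
      by (subst nn_integral_multc) (simp_all add: mult.commute)
    also have "\<dots> = (\<integral>\<^sup>+x. \<integral>\<^sup>+y. g (f x) * indicator B (- f x + y) \<partial>lborel \<partial>lborel)"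
    proof (rule nn_integral_cong)
      fix x
      have "(\<integral>\<^sup>+y. indicator B (- f x + y) \<partial>lborel) = ennreal b"
        by (subst nn_integral_lborel_translate) (simp_all add: b)
      then show "g (f x) * ennreal b = (\<integral>\<^sup>+y. g (f x) * indicator B (- f x + y) \<partial>lborel)"
        by (subst nn_integral_cmult) simp_all
    qed
    also have "\<dots> = (\<integral>\<^sup>+y. \<integral>\<^sup>+x. g (f x) * indicator B (- f x + y) \<partial>lborel \<partial>lborel)"
      by (rule lborel_pair.Fubini') simp
    also have "\<dots> = (\<integral>\<^sup>+y. \<integral>\<^sup>+x. g (f x + y) * indicator B (- f x) \<partial>lborel \<partial>lborel)"
    proof (rule nn_integral_cong)
      fix y
      \<comment> \<open>Translating x by a preimage of y moves y out of the indicator and into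
        g.\<close>
      obtain u where u: "f u = y" using f(2) by (metis bij_pointE)
      have "(\<integral>\<^sup>+x. g (f x) * indicator B (- f x + y) \<partial>lborel) = (\<integral>\<^sup>+x. g (f (u + x)) * indicator B (- f (u + x) + y) \<partial>lborel)"
        by (rule nn_integral_lborel_translate[symmetric]) simp
      also have "\<dots> = (\<integral>\<^sup>+x. g (f x + y) * indicator B (- f x) \<partial>lborel)"
        using u linear_add[OF f(1)] by (simp add: add.commute)
      finally show "(\<integral>\<^sup>+x. g (f x) * indicator B (- f x + y) \<partial>lborel) = (\<integral>\<^sup>+x. g (f x + y) * indicator B (- f x) \<partial>lborel)" .
    qed
    also have "\<dots> = (\<integral>\<^sup>+x. \<integral>\<^sup>+y. g (f x + y) * indicator B (- f x) \<partial>lborel \<partial>lborel)"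
      by (rule lborel_pair.Fubini'[symmetric]) simp
    also have "\<dots> = (\<integral>\<^sup>+x. (\<integral>\<^sup>+y. g y \<partial>lborel) * indicator B (- f x) \<partial>lborel)"
      by (intro nn_integral_cong) (simp add: nn_integral_multc nn_integral_lborel_translate)
    also have "\<dots> = K * (\<integral>\<^sup>+x. g x \<partial>lborel)"
      unfolding K_def by (subst nn_integral_cmult) (simp_all add: mult.commute)
    finally show ?thesis .
  qed
  have "K \<noteq> 0"
  proof
    assume "K = 0"
    with main[of "\<lambda>_. 1"] \<open>b > 0\<close> show False by (simp add: ennreal_mult_top)
  qed
  \<comment> \<open>With the indicator of the image of the ball under \<open>f\<close> as g, the
    left side is b^2, finite and positive, while top times any value is 0 or top.\<close>
  moreover have "K \<noteq> top"
  proof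
    assume K: "K = top"
    obtain h where h: "linear h" "\<And>x. h (f x) = x"
      using linear_injective_left_inverse[OF f(1)] f(2) by (metis bij_is_inj comp_apply id_apply)
    have [measurable]: "h \<in> borel_measurable borel"
      using h by (auto intro!: borel_measurable_continuous_onI linear_continuous_on linear_conv_bounded_linear[THEN iffD1])
    have "ennreal b * ennreal b = K * (\<integral>\<^sup>+x. indicator B (h x) \<partial>lborel)"
      using main[of "\<lambda>x. indicator B (h x)"] by (simp add: h b)
    then have "ennreal (b * b) = top * (\<integral>\<^sup>+x. indicator B (h x) \<partial>lborel)"
      using K \<open>b > 0\<close> by (simp add: ennreal_mult)
    then show False
      using \<open>b > 0\<close> by (cases "(\<integral>\<^sup>+x. indicator B (h x) \<partial>lborel) = 0") (auto simp: ennreal_top_mult)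
  qed
  ultimately obtain k where k: "K = ennreal k" "k > 0"
    by (metis ennreal_cases ennreal_eq_0_iff linorder_not_less top_neq_ennreal infinity_ennreal_def)
  show ?thesis
  proof (rule that[of "k / b"])
    show "k / b > 0" using k \<open>b > 0\<close> by simp
    fix g :: "'a \<Rightarrow> ennreal" assume "g \<in> borel_measurable borel"
    from main[OF this] have "ennreal (1 / b) * (ennreal b * (\<integral>\<^sup>+x. g (f x) \<partial>lborel)) = ennreal (1 / b) * (ennreal k * (\<integral>\<^sup>+x. g x \<partial>lborel))"
      by (simp only: k)
    then show "(\<integral>\<^sup>+x. g (f x) \<partial>lborel) = ennreal (k / b) * (\<integral>\<^sup>+x. g x \<partial>lborel)"
      using \<open>b > 0\<close> k(2) by (simp add: mult.assoc[symmetric] ennreal_mult[symmetric])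
  qed
qed

lemma nn_integral_lborel_scale_unique:
  assumes "\<And>g :: 'a::euclidean_space \<Rightarrow> ennreal. g \<in> borel_measurable borel \<Longrightarrow> ennreal c * (\<integral>\<^sup>+x. g x \<partial>lborel) = ennreal d * (\<integral>\<^sup>+x. g x \<partial>lborel)"
    "c \<ge> 0" "d \<ge> 0"
  shows "c = d"
proof -
  define b where "b = measure lborel (ball (0::'a) 1)"
  have "emeasure lborel (ball (0::'a) 1) = ennreal b"
    unfolding b_def by (rule emeasure_eq_ennreal_measure) (use emeasure_lborel_ball_finite in \<open>simp add: less_top\<close>)
  moreover have "b > 0" unfolding b_def using content_ball_pos[of 1 "0::'a"] by simp
  moreover have "(indicator (ball 0 1) :: 'a \<Rightarrow> ennreal) \<in> borel_measurable borel"
    by (intro borel_measurable_indicator) simp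
  ultimately show ?thesis
    using assms(1)[of "indicator (ball 0 1)"] assms(2,3) by (simp add: ennreal_mult[symmetric])
qed

text \<open>Applying the map twice squares the scale factor, so the positive factor is 1.\<close>

lemma nn_integral_lborel_linear_involution:
  fixes f :: "'a::euclidean_space \<Rightarrow> 'a"
  assumes f: "linear f" "\<And>x. f (f x) = x" and g: "g \<in> borel_measurable borel"
  shows "(\<integral>\<^sup>+x. g (f x) \<partial>lborel) = (\<integral>\<^sup>+x. g x \<partial>lborel)"
proof -
  have "bij f" using f(2) by (rule involuntory_imp_bij)
  then obtain c where c: "c > 0" "\<And>g. g \<in> borel_measurable borel \<Longrightarrow> (\<integral>\<^sup>+x. g (f x) \<partial>lborel) = ennreal c * (\<integral>\<^sup>+x. g x \<partial>lborel)"
    using nn_integral_lborel_linear_bij_scale[OF f(1)] by metis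
  have [measurable]: "f \<in> borel_measurable borel"
    using f by (auto intro!: borel_measurable_continuous_onI linear_continuous_on linear_conv_bounded_linear[THEN iffD1])
  have "c * c = 1"
  proof (rule nn_integral_lborel_scale_unique[where 'a = 'a])
    fix g :: "'a \<Rightarrow> ennreal" assume [measurable]: "g \<in> borel_measurable borel"
    have "(\<integral>\<^sup>+x. g x \<partial>lborel) = (\<integral>\<^sup>+x. g (f (f x)) \<partial>lborel)" by (simp add: f)
    also have "\<dots> = ennreal c * (ennreal c * (\<integral>\<^sup>+x. g x \<partial>lborel))"
      by (simp add: c(2)[of "\<lambda>x. g (f x)"] c(2)[of g])
    finally show "ennreal (c * c) * (\<integral>\<^sup>+x. g x \<partial>lborel) = ennreal 1 * (\<integral>\<^sup>+x. g x \<partial>lborel)"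
      using c(1) by (simp add: ennreal_mult mult.assoc)
  qed (use c in auto)
  then have "c = 1" using c(1) by (simp add: square_eq_1_iff)
  then show ?thesis using c(2)[OF g] by simp
qed

lemma abs_det_matrix_involution:
  fixes f :: "real ^ 'n \<Rightarrow> real ^ 'n"
  assumes "linear f" "\<And>x. f (f x) = x"
  shows "\<bar>det (matrix f)\<bar> = 1"
proof -
  have "f \<circ> f = id" using assms(2) by auto
  then have "matrix f ** matrix f = mat 1"
    using matrix_compose[OF assms(1) assms(1)] by (simp add: matrix_id_mat_1)
  then have "det (matrix f) * det (matrix f) = 1"
    by (metis det_I det_mul)
  then show ?thesis by (metis abs_1 abs_mult_self_eq abs_square_eq_1 power2_eq_square)
qed

text \<open>Determinants multiply under composition, as do the scale factors, so elementary maps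
  suffice: diagonal maps by affine substitution, coordinate swaps as involutions, and shears. A map
  with a vanishing coordinate has determinant zero, which makes the claim vacuous.\<close>

lemma nn_integral_lborel_linear:
  fixes f :: "real ^ 'n \<Rightarrow> real ^ 'n"
  assumes "linear f" "det (matrix f) \<noteq> 0" "g \<in> borel_measurable borel"
  shows "(\<integral>\<^sup>+x. g x \<partial>lborel) = ennreal \<bar>det (matrix f)\<bar> * (\<integral>\<^sup>+x. g (f x) \<partial>lborel)"
proof -
  let ?P = "\<lambda>f :: real ^ 'n \<Rightarrow> real ^ 'n. det (matrix f) \<noteq> 0 \<longrightarrow>
    (\<forall>g\<in>borel_measurable borel. (\<integral>\<^sup>+x. g x \<partial>lborel) = ennreal \<bar>det (matrix f)\<bar> * (\<integral>\<^sup>+x. g (f x) \<partial>lborel))"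
  have involution: "?P f" if "linear f" "\<And>x. f (f x) = x" for f
    using nn_integral_lborel_linear_involution[OF that] abs_det_matrix_involution[OF that] by simp
  have "?P f"
  proof (rule induct_linear_elementary[OF assms(1)])
    fix f h :: "real ^ 'n \<Rightarrow> real ^ 'n"
    assume lin: "linear f" "linear h" and P: "?P f" "?P h"
    have det: "det (matrix (f \<circ> h)) = det (matrix f) * det (matrix h)"
      by (simp add: matrix_compose lin det_mul)
    have [measurable]: "f \<in> borel_measurable borel"
      using lin by (auto intro!: borel_measurable_continuous_onI linear_continuous_on linear_conv_bounded_linear[THEN iffD1])
    show "?P (f \<circ> h)"
    proof (intro impI ballI)
      fix g :: "real ^ 'n \<Rightarrow> ennreal"
      assume "det (matrix (f \<circ> h)) \<noteq> 0" and [measurable]: "g \<in> borel_measurable borel"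
      then have "det (matrix f) \<noteq> 0" "det (matrix h) \<noteq> 0" by (auto simp: det)
      then have "(\<integral>\<^sup>+x. g x \<partial>lborel) = ennreal \<bar>det (matrix f)\<bar> * (\<integral>\<^sup>+x. g (f x) \<partial>lborel)"
        "(\<integral>\<^sup>+x. g (f x) \<partial>lborel) = ennreal \<bar>det (matrix h)\<bar> * (\<integral>\<^sup>+x. g (f (h x)) \<partial>lborel)"
        using P(1)[rule_format, of g] P(2)[rule_format, of "\<lambda>x. g (f x)"] by auto
      then show "(\<integral>\<^sup>+x. g x \<partial>lborel) = ennreal \<bar>det (matrix (f \<circ> h))\<bar> * (\<integral>\<^sup>+x. g ((f \<circ> h) x) \<partial>lborel)"
        by (simp add: det abs_mult ennreal_mult mult.assoc)
    qed
  next
    fix f :: "real ^ 'n \<Rightarrow> real ^ 'n" and i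
    assume "linear f" and 0: "\<And>x. f x $ i = 0"
    then have "\<not> inj f"
      by (metis linear_injective_imp_surjective one_neq_zero surjE vec_component)
    then show "?P f" using det_nz_iff_inj[OF \<open>linear f\<close>] by blast
  next
    fix c :: "'n \<Rightarrow> real"
    let ?f = "\<lambda>x::real ^ 'n. \<chi> i. c i * x $ i"
    have det: "det (matrix ?f) = (\<Prod>i\<in>UNIV. c i)"
      by (simp add: axis_def matrix_def det_diagonal)
    show "?P ?f"
    proof (intro impI ballI)
      fix g :: "real ^ 'n \<Rightarrow> ennreal"
      assume "det (matrix ?f) \<noteq> 0" and [measurable]: "g \<in> borel_measurable borel"
      then have c: "c i \<noteq> 0" for i by (auto simp: det)
      \<comment> \<open>The diagonal map written over the Euclidean basis with zero shift, the shape
        in which \<open>lborel_affine_euclidean\<close> states the substitution.\<close>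
      define T where "T = (\<lambda>x::real ^ 'n. 0 + (\<Sum>j\<in>Basis. ((\<Sum>i\<in>UNIV. c i *\<^sub>R axis i 1) \<bullet> j * (x \<bullet> j)) *\<^sub>R j))"
      have coord: "(\<Sum>i\<in>UNIV. c i *\<^sub>R axis i 1) \<bullet> axis k (1::real) = c k" for k
        by (simp add: inner_sum_left inner_axis_axis if_distrib cong: if_cong)
      have sum_Basis: "(\<Sum>j\<in>Basis. F j) = (\<Sum>k\<in>UNIV. F (axis k 1))" for F :: "real ^ 'n \<Rightarrow> real ^ 'n"
        by (simp add: Basis_real_vec sum.reindex inj_axis_1)
      have prod_Basis: "(\<Prod>j\<in>Basis. F j) = (\<Prod>k\<in>UNIV. F (axis k 1))" for F :: "real ^ 'n \<Rightarrow> real"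
        by (simp add: Basis_real_vec prod.reindex inj_axis_1)
      have T: "T = ?f"
      proof -
        have "x \<bullet> axis k 1 = x $ k" for x :: "real ^ 'n" and k by (simp add: inner_axis)
        then show ?thesis
          unfolding T_def sum_Basis coord by (auto simp: fun_eq_iff vec_eq_iff axis_def if_distrib cong: if_cong)
      qed
      have [measurable]: "?f \<in> borel_measurable borel"
        by (intro borel_measurable_continuous_onI continuous_intros)
      have "(lborel :: (real ^ 'n) measure) = density (distr lborel borel T) (\<lambda>_. (\<Prod>j\<in>Basis. \<bar>(\<Sum>i\<in>UNIV. c i *\<^sub>R axis i (1::real)) \<bullet> j\<bar>))"
        unfolding T_def by (rule lborel_affine_euclidean) (auto simp: coord c Basis_real_vec)
      then have "(lborel :: (real ^ 'n) measure) = density (distr lborel borel ?f) (\<lambda>_. ennreal \<bar>det (matrix ?f)\<bar>)"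
        unfolding prod_Basis coord T det by (simp add: abs_prod prod_ennreal)
      then have "(\<integral>\<^sup>+x. g x \<partial>lborel) = (\<integral>\<^sup>+x. g x \<partial>density (distr lborel borel ?f) (\<lambda>_. ennreal \<bar>det (matrix ?f)\<bar>))"
        by simp
      also have "\<dots> = ennreal \<bar>det (matrix ?f)\<bar> * (\<integral>\<^sup>+x. g (?f x) \<partial>lborel)"
        by (subst nn_integral_density) (simp_all add: nn_integral_distr nn_integral_cmult)
      finally show "(\<integral>\<^sup>+x. g x \<partial>lborel) = ennreal \<bar>det (matrix ?f)\<bar> * (\<integral>\<^sup>+x. g (?f x) \<partial>lborel)" .
    qed
  next
    fix m n :: 'n
    assume "m \<noteq> n"
    show "?P (\<lambda>x. \<chi> i. x $ Transposition.transpose m n i)"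
      by (rule involution) (auto intro!: linearI simp: vec_eq_iff)
  next
    fix m n :: 'n
    assume mn: "m \<noteq> n"
    define h where "h = (\<lambda>x::real ^ 'n. \<chi> i. if i = m then x $ m + x $ n else x $ i)"
    define D where "D = (\<lambda>x::real ^ 'n. \<chi> i. if i = n then - x $ i else x $ i)"
    have lin: "linear h" "linear D"
      by (auto intro!: linearI simp: h_def D_def vec_eq_iff algebra_simps)
    have inv_D: "D (D x) = x" for x by (simp add: D_def vec_eq_iff)
    have inv: "(D \<circ> h) ((D \<circ> h) x) = x" for x using mn by (auto simp: h_def D_def vec_eq_iff)
    \<comment> \<open>A shear is a product of two involutions, so it preserves volume.\<close>
    have lin_Dh: "linear (D \<circ> h)" by (rule linear_compose[OF lin])
    have det: "\<bar>det (matrix h)\<bar> = 1"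
      using abs_det_matrix_involution[OF lin_Dh inv] abs_det_matrix_involution[OF lin(2) inv_D]
      unfolding matrix_compose[OF lin] det_mul abs_mult by simp
    have "?P h"
    proof (intro impI ballI)
      fix g :: "real ^ 'n \<Rightarrow> ennreal"
      assume [measurable]: "g \<in> borel_measurable borel"
      have [measurable]: "D \<in> borel_measurable borel"
        using lin by (intro borel_measurable_continuous_onI linear_continuous_on linear_conv_bounded_linear[THEN iffD1])
      have "(\<integral>\<^sup>+x. g x \<partial>lborel) = (\<integral>\<^sup>+x. g (D x) \<partial>lborel)"
        by (rule nn_integral_lborel_linear_involution[symmetric, OF lin(2) inv_D]) simp
      also have "\<dots> = (\<integral>\<^sup>+x. g (D ((D \<circ> h) x)) \<partial>lborel)"
        by (rule nn_integral_lborel_linear_involution[symmetric, OF lin_Dh inv, where g = "\<lambda>x. g (D x)"]) simp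
      finally show "(\<integral>\<^sup>+x. g x \<partial>lborel) = ennreal \<bar>det (matrix h)\<bar> * (\<integral>\<^sup>+x. g (h x) \<partial>lborel)"
        by (simp add: det inv_D)
    qed
    then show "?P (\<lambda>x. \<chi> i. if i = m then x $ m + x $ n else x $ i)" by (simp only: h_def)
  qed
  then show ?thesis using assms by blast
qed

section \<open>Standard normal vectors\<close>

lemma dot_matrix_vector_transpose: "x \<bullet> (A *v y) = (transpose A *v x) \<bullet> y" for A :: "real ^ 'm ^ 'n"
  by (metis dot_lmul_matrix transpose_matrix_vector)

lemma sum_UNIV_sum: "(\<Sum>k\<in>(UNIV :: ('a::finite + 'b::finite) set). f k) = (\<Sum>i\<in>UNIV. f (Inl i)) + (\<Sum>i\<in>UNIV. f (Inr i))"
  by (subst UNIV_Plus_UNIV[symmetric]) (simp add: sum.Plus o_def del: UNIV_Plus_UNIV)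

lemma prod_UNIV_sum: "(\<Prod>k\<in>(UNIV :: ('a::finite + 'b::finite) set). f k) = (\<Prod>i\<in>UNIV. f (Inl i)) * (\<Prod>i\<in>UNIV. f (Inr i))"
  by (subst UNIV_Plus_UNIV[symmetric]) (simp add: prod.Plus o_def del: UNIV_Plus_UNIV)

section \<open>Factorisation of positive semidefinite matrices\<close>

lemma outer_square_mult: "outer_square u *v y = (u \<bullet> y) *\<^sub>R u"
  by (simp add: outer_square_def matrix_vector_mult_def inner_vec_def vec_eq_iff sum_distrib_left mult_ac)

text \<open>Polarisation: by symmetry the quadratic form determines the bilinear form.\<close>

lemma symmetric_form_zero:
  fixes S :: "real ^ 'n ^ 'n"
  assumes sym: "transpose S = S" and zero: "\<And>x. x \<bullet> (S *v x) = 0"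
  shows "S = 0"
proof -
  have "x \<bullet> (S *v y) = 0" for x y
  proof -
    have "(x + y) \<bullet> (S *v (x + y)) = x \<bullet> (S *v x) + y \<bullet> (S *v y) + 2 * (x \<bullet> (S *v y))"
      using dot_matrix_vector_transpose[of y S x] sym
      by (simp add: matrix_vector_right_distrib inner_add_left inner_add_right inner_commute)
    then show ?thesis using zero by simp
  qed
  then have "S *v y = 0" for y by (metis inner_eq_zero_iff)
  then show ?thesis by (simp add: matrix_eq)
qed

text \<open>Subtracting a suitable rank one matrix from a nonzero positive semidefinite matrix
  keeps it positive semidefinite and enlarges its kernel.\<close>

lemma pos_semidef_sum_outer_squares:
  fixes S :: "real ^ 'n ^ 'n"
  assumes "pos_semidef S" "CARD('n) \<le> r + dim {x. S *v x = 0}" "r \<le> CARD('n)"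
  shows "\<exists>(J :: 'n set) v. card J \<le> r \<and> S = (\<Sum>j\<in>J. outer_square (v j))"
  using assms
proof (induction r arbitrary: S)
  case 0
  have "dim {x. S *v x = 0} \<ge> DIM(real ^ 'n)" using 0 by simp
  then have "span {x. S *v x = 0} = UNIV" by (metis dim_eq_full dim_subset_UNIV le_antisym)
  moreover have "subspace {x. S *v x = 0}"
    by (auto simp: subspace_def matrix_vector_right_distrib matrix_vector_mult_scaleR)
  ultimately have "S *v x = 0" for x by (metis (mono_tags, lifting) UNIV_I mem_Collect_eq span_eq_iff)
  then have "S = 0" by (simp add: matrix_eq)
  then show ?case by (intro exI[of _ "{}"]) auto
next
  case (Suc r)
  have sym: "transpose S = S" and psd: "\<And>x. 0 \<le> x \<bullet> (S *v x)"
    using Suc.prems(1) by (auto simp: pos_semidef_def)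
  show ?case
  proof (cases "S = 0")
    case True
    then show ?thesis by (intro exI[of _ "{}"]) auto
  next
    case False
    then obtain x where "x \<bullet> (S *v x) \<noteq> 0" using symmetric_form_zero[OF sym] by blast
    define p where "p = x \<bullet> (S *v x)"
    have p: "p > 0" using psd[of x] \<open>x \<bullet> (S *v x) \<noteq> 0\<close> by (simp add: p_def)
    \<comment> \<open>The normalisation by x' S x makes \<open>S'\<close> send x to zero, while the
      kernel of \<open>S\<close> stays in the kernel of \<open>S'\<close>.\<close>
    define u where "u = (1 / sqrt p) *\<^sub>R (S *v x)"
    define S' where "S' = S - outer_square u"
    have S'_mult: "S' *v y = S *v y - (((S *v x) \<bullet> y) / p) *\<^sub>R (S *v x)" for y
      using p by (simp add: S'_def matrix_vector_mult_diff_rdistrib outer_square_mult u_def)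
    have sym': "(S *v y) \<bullet> z = y \<bullet> (S *v z)" for y z
      using dot_matrix_vector_transpose[of y S z] sym by simp
    have "pos_semidef S'"
      unfolding pos_semidef_def
    proof (intro conjI allI)
      have "transpose (outer_square u) = outer_square u"
        by (simp add: outer_square_def transpose_def vec_eq_iff mult.commute)
      moreover have "transpose (S - outer_square u) = transpose S - transpose (outer_square u)"
        by (simp add: transpose_def vec_eq_iff)
      ultimately show "transpose S' = S'" using sym by (simp add: S'_def)
      fix y
      \<comment> \<open>This \<open>a\<close> minimises the form of \<open>S\<close> at y - a x, and
        the minimum is the form of \<open>S'\<close> at y.\<close>
      define a where "a = ((S *v x) \<bullet> y) / p"
      have "0 \<le> (y - a *\<^sub>R x) \<bullet> (S *v (y - a *\<^sub>R x))" by (rule psd)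
      also have "\<dots> = y \<bullet> (S *v y) - 2 * a * ((S *v x) \<bullet> y) + a\<^sup>2 * p"
        using sym'[of x y]
        by (simp add: matrix_vector_mult_diff_distrib matrix_vector_mult_scaleR inner_diff_left inner_diff_right p_def
            power2_eq_square algebra_simps inner_commute)
      also have "\<dots> = y \<bullet> (S' *v y)"
        using p by (simp add: S'_mult a_def inner_diff_right inner_commute power2_eq_square field_simps)
      finally show "0 \<le> y \<bullet> (S' *v y)" .
    qed
    moreover have "dim {y. S *v y = 0} < dim {y. S' *v y = 0}"
    proof -
      have sub: "subspace {y. A *v y = 0}" for A :: "real ^ 'n ^ 'n"
        by (auto simp: subspace_def matrix_vector_right_distrib matrix_vector_mult_scaleR)
      have "{y. S *v y = 0} \<subseteq> {y. S' *v y = 0}"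
        by (auto simp: S'_mult sym')
      moreover have "x \<notin> {y. S *v y = 0}" "x \<in> {y. S' *v y = 0}"
        using p by (auto simp: S'_mult p_def inner_commute)
      ultimately have "{y. S *v y = 0} \<subset> {y. S' *v y = 0}" by blast
      then show ?thesis using sub by (intro dim_psubset) (simp add: span_eq_iff[THEN iffD2])
    qed
    then have "CARD('n) \<le> r + dim {y. S' *v y = 0}" using Suc.prems(2) by linarith
    ultimately obtain J :: "'n set" and v where J: "card J \<le> r" "S' = (\<Sum>j\<in>J. outer_square (v j))"
      using Suc.IH Suc.prems(3) by (metis Suc_leD)
    \<comment> \<open>At most r < CARD('n) indices are in use, so one is free for \<open>u\<close>.
      Indices from the dimension type make the later factor a square matrix.\<close>
    then have "J \<noteq> UNIV" using Suc.prems(3) by auto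
    then obtain k where k: "k \<notin> J" by blast
    have "S = (\<Sum>j\<in>insert k J. outer_square ((v(k := u)) j))"
    proof -
      have "(\<Sum>j\<in>J. outer_square ((v(k := u)) j)) = (\<Sum>j\<in>J. outer_square (v j))"
        using k by (intro sum.cong) auto
      then show ?thesis using k J(2) by (simp add: S'_def diff_eq_eq add.commute)
    qed
    moreover have "card (insert k J) \<le> Suc r" using J(1) k by simp
    ultimately show ?thesis by blast
  qed
qed

text \<open>The vectors become the columns of \<open>A\<close>, padded by zero columns. This
  guarantees that the choice in \<open>centered_normal\<close> has a witness.\<close>

lemma pos_semidef_factor:
  fixes S :: "real ^ 'n ^ 'n"
  assumes "pos_semidef S"
  shows "\<exists>A :: real ^ 'n ^ 'n. A ** transpose A = S"
proof -
  obtain J :: "'n set" and v where S: "S = (\<Sum>j\<in>J. outer_square (v j))"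
    using pos_semidef_sum_outer_squares[OF assms, of "CARD('n)"] by auto
  define A :: "real ^ 'n ^ 'n" where "A = (\<chi> i j. if j \<in> J then v j $ i else 0)"
  have "(A ** transpose A) $ i $ k = S $ i $ k" for i k
  proof -
    have "(A ** transpose A) $ i $ k = (\<Sum>j\<in>UNIV. if j \<in> J then v j $ i * v j $ k else 0)"
      by (auto simp: A_def matrix_matrix_mult_def transpose_def intro!: sum.cong)
    also have "\<dots> = S $ i $ k"
      by (simp add: S outer_square_def sum.If_cases)
    finally show ?thesis .
  qed
  then show ?thesis by (intro exI[of _ A]) (simp add: vec_eq_iff)
qed

section \<open>Laws of standard normal vectors\<close>

abbreviation std_normal :: "real measure" where
  "std_normal \<equiv> density lborel (\<lambda>x. ennreal (std_normal_density x))"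

lemma sets_std_normal_vec [simp, measurable_cong]: "sets std_normal_vec = sets borel"
  and space_std_normal_vec [simp]: "space std_normal_vec = UNIV"
  by (simp_all add: std_normal_vec_def)

lemma prod_std_normal_density:
  "(\<Prod>i\<in>UNIV. std_normal_density (x $ i)) = exp (- (x \<bullet> x) / 2) / sqrt (2 * pi) ^ CARD('n)" for x :: "real ^ 'n"
proof -
  have "(\<Prod>i\<in>UNIV. std_normal_density (x $ i)) = (\<Prod>i\<in>(UNIV :: 'n set). 1 / sqrt (2 * pi)) * (\<Prod>i\<in>UNIV. exp (- (x $ i)\<^sup>2 / 2))"
    by (simp only: std_normal_density_def prod.distrib)
  also have "(\<Prod>i\<in>UNIV. exp (- (x $ i)\<^sup>2 / 2)) = exp (- (x \<bullet> x) / 2)"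
    by (simp add: exp_sum[symmetric] inner_vec_def power2_eq_square sum_negf sum_divide_distrib)
  finally show ?thesis by (simp add: power_divide)
qed

lemma measurable_prod_std_normal_density [measurable]:
  "(\<lambda>x :: real ^ 'n. \<Prod>i\<in>UNIV. std_normal_density (x $ i)) \<in> borel_measurable borel"
  by measurable

lemma emeasure_std_normal_vec_box:
  assumes A: "\<And>i. A i \<in> sets borel"
  shows "emeasure std_normal_vec {x :: real ^ 'n. \<forall>i. x $ i \<in> A i} = (\<Prod>i\<in>UNIV. emeasure std_normal (A i))"
proof -
  \<comment> \<open>\<open>nn_integral_lborel_prod\<close> indexes its factors by basis vectors, so
    \<open>f\<close> recovers the coordinate from the axis vector.\<close>
  define f where "f = (\<lambda>b y. ennreal (std_normal_density y) * indicator (A (SOME i. b = axis i (1::real))) y)"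
  have f: "f (axis i 1) = (\<lambda>y. ennreal (std_normal_density y) * indicator (A i) y)" for i
    by (simp add: f_def axis_eq_axis)
  have [measurable]: "A i \<in> sets borel" for i by (rule A)
  have "{x :: real ^ 'n. \<forall>i. x $ i \<in> A i} \<in> sets borel"
    by measurable
  then have "emeasure std_normal_vec {x :: real ^ 'n. \<forall>i. x $ i \<in> A i} =
      (\<integral>\<^sup>+x. ennreal (\<Prod>i\<in>UNIV. std_normal_density (x $ i)) * indicator {x. \<forall>i. x $ i \<in> A i} x \<partial>lborel)"
    unfolding std_normal_vec_def by (subst emeasure_density) simp_all
  also have "\<dots> = (\<integral>\<^sup>+x. (\<Prod>b\<in>Basis. f b (x \<bullet> b)) \<partial>lborel)"
  proof (rule nn_integral_cong)
    fix x :: "real ^ 'n"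
    have "indicator {x. \<forall>i. x $ i \<in> A i} x = (\<Prod>i\<in>UNIV. indicator (A i) (x $ i) :: ennreal)"
    proof (cases "\<forall>i. x $ i \<in> A i")
      case False
      then obtain i where "x $ i \<notin> A i" by blast
      then have "(\<Prod>i\<in>UNIV. indicator (A i) (x $ i) :: ennreal) = 0" by (intro prod_zero bexI[of _ i]) auto
      then show ?thesis using False by simp
    qed simp
    then show "ennreal (\<Prod>i\<in>UNIV. std_normal_density (x $ i)) * indicator {x. \<forall>i. x $ i \<in> A i} x = (\<Prod>b\<in>Basis. f b (x \<bullet> b))"
      by (simp add: Basis_real_vec prod.reindex inj_axis_1 f inner_axis prod.distrib prod_ennreal)
  qed
  also have "\<dots> = (\<Prod>b\<in>Basis. \<integral>\<^sup>+y. f b y \<partial>lborel)"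
    by (rule nn_integral_lborel_prod) (auto simp: f_def)
  also have "\<dots> = (\<Prod>i\<in>UNIV. emeasure std_normal (A i))"
    by (simp add: Basis_real_vec prod.reindex inj_axis_1 f emeasure_density)
  finally show ?thesis .
qed

lemma prob_space_std_normal: "prob_space std_normal"
  by (rule prob_space_normal_density) simp

lemma prob_space_std_normal_vec: "prob_space (std_normal_vec :: (real ^ 'n) measure)"
proof (rule prob_spaceI)
  have "emeasure std_normal UNIV = 1"
    using prob_space.emeasure_space_1[OF prob_space_std_normal] by simp
  then show "emeasure (std_normal_vec :: (real ^ 'n) measure) (space std_normal_vec) = 1"
    using emeasure_std_normal_vec_box[where A = "\<lambda>_::'n. UNIV"] by simp
qed

text \<open>Closed lower orthants are stable under intersection, generate the Borel sets and exhaust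
  the space along the diagonal.\<close>

lemma measure_eqI_orthants:
  fixes M N :: "(real ^ 'n) measure"
  assumes "sets M = sets borel" "sets N = sets borel" "finite_measure M"
    and "\<And>c. emeasure M {x. \<forall>i. x $ i \<le> c $ i} = emeasure N {x. \<forall>i. x $ i \<le> c $ i}"
  shows "M = N"
proof (rule measure_eqI_generator_eq)
  have atMost: "{..a} = {x. \<forall>i. x $ i \<le> a $ i}" for a :: "real ^ 'n" by (auto simp: less_eq_vec_def)
  show "Int_stable (range (\<lambda>a::real ^ 'n. {..a}))"
  proof -
    have "{..a} \<inter> {..b} = {..inf a b}" for a b :: "real ^ 'n" by auto
    then show ?thesis by (auto simp: Int_stable_def)
  qed
  show "sets M = sigma_sets UNIV (range (\<lambda>a::real ^ 'n. {..a}))" "sets N = sigma_sets UNIV (range (\<lambda>a::real ^ 'n. {..a}))"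
    using assms(1,2) borel_eq_atMost[where 'a = "real ^ 'n"] by (metis sets_measure_of top_greatest Pow_UNIV)+
  show "emeasure M X = emeasure N X" if "X \<in> range (\<lambda>a::real ^ 'n. {..a})" for X
    using that assms(4) by (auto simp: atMost)
  show "range (\<lambda>n::nat. {..(\<chi> i. real n) :: real ^ 'n}) \<subseteq> range (\<lambda>a. {..a})" by auto
  show "(\<Union>n::nat. {..(\<chi> i. real n) :: real ^ 'n}) = UNIV"
  proof -
    have "\<exists>n::nat. \<forall>i. x $ i \<le> real n" for x :: "real ^ 'n"
    proof -
      obtain n :: nat where "norm x \<le> real n" using real_arch_simple by blast
      then show ?thesis by (meson component_le_norm_cart abs_le_D1 order_trans)
    qed
    then show ?thesis by (auto simp: atMost)
  qed
  show "emeasure M {..(\<chi> i. real n) :: real ^ 'n} \<noteq> \<infinity>" for n :: nat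
    using finite_measure.emeasure_finite[OF assms(3)] by simp
qed simp

text \<open>The density depends only on x \<bullet> x, and the determinant has absolute value
  1.\<close>

lemma std_normal_vec_orthogonal_invariant:
  fixes T :: "real ^ 'n ^ 'n"
  assumes T: "orthogonal_matrix T" and [measurable]: "A \<in> sets borel"
  shows "emeasure std_normal_vec {x. T *v x \<in> A} = emeasure std_normal_vec A"
proof -
  have lin: "linear ((*v) T)" by simp
  have [measurable]: "(*v) T \<in> borel_measurable borel"
    by (intro borel_measurable_continuous_onI linear_continuous_on linear_conv_bounded_linear[THEN iffD1] lin)
  have det: "\<bar>det (matrix ((*v) T))\<bar> = 1" using det_orthogonal_matrix[OF T] by auto
  have norm: "(T *v x) \<bullet> (T *v x) = x \<bullet> x" for x
    using T orthogonal_transformation_matrix[of "(*v) T"] by (simp add: orthogonal_transformation_def)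
  have "emeasure std_normal_vec A = (\<integral>\<^sup>+x. ennreal (\<Prod>i\<in>UNIV. std_normal_density (x $ i)) * indicator A x \<partial>lborel)"
    unfolding std_normal_vec_def by (subst emeasure_density) simp_all
  also have "\<dots> = ennreal \<bar>det (matrix ((*v) T))\<bar> * (\<integral>\<^sup>+x. ennreal (\<Prod>i\<in>UNIV. std_normal_density ((T *v x) $ i)) * indicator A (T *v x) \<partial>lborel)"
    by (rule nn_integral_lborel_linear[OF lin]) (use det in auto)
  also have "\<dots> = (\<integral>\<^sup>+x. ennreal (\<Prod>i\<in>UNIV. std_normal_density (x $ i)) * indicator {x. T *v x \<in> A} x \<partial>lborel)"
    unfolding det prod_std_normal_density norm by (simp add: indicator_def)
  also have "\<dots> = emeasure std_normal_vec {x. T *v x \<in> A}"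
    unfolding std_normal_vec_def by (subst emeasure_density) simp_all
  finally show ?thesis by simp
qed

text \<open>The orthogonal complement of n orthonormal rows in dimension 2n has dimension n, so an
  orthonormal basis of it is indexed by the second summand.\<close>

lemma extend_orthonormal_rows:
  fixes r :: "'n::finite \<Rightarrow> real ^ ('n + 'n)"
  assumes r: "\<And>i j. r i \<bullet> r j = (if i = j then 1 else 0)"
  obtains T :: "real ^ ('n + 'n) ^ ('n + 'n)" where "orthogonal_matrix T" "\<And>i. row (Inl i) T = r i"
proof -
  have inj: "inj r"
  proof (rule injI)
    fix i j assume "r i = r j"
    then show "i = j" using r[of i j] r[of i i] by (auto split: if_splits)
  qed
  have "pairwise orthogonal (range r)"
    using r by (auto simp: pairwise_def orthogonal_def)
  moreover have "0 \<notin> range r" using r by (metis imageE inner_zero_left zero_neq_one)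
  ultimately have "independent (range r)" by (rule pairwise_orthogonal_independent)
  then have dim: "dim (span (range r)) = CARD('n)"
    using inj by (simp add: dim_eq_card_independent card_image)
  define V where "V = {y. \<forall>x\<in>span (range r). orthogonal x y}"
  have "dim V + dim (span (range r)) = DIM(real ^ ('n + 'n))"
    using dim_subspace_orthogonal_to_vectors[of "span (range r)" UNIV] by (simp add: V_def)
  then have "dim V = CARD('n)" using dim by simp
  moreover have "subspace V"
    by (auto simp: V_def subspace_def orthogonal_clauses)
  ultimately obtain B where B: "B \<subseteq> V" "pairwise orthogonal B" "\<And>x. x \<in> B \<Longrightarrow> norm x = 1" "independent B" "card B = CARD('n)"
    using orthonormal_basis_subspace by metis
  have "finite B" using B(4) by (rule independent_imp_finite)
  then obtain h where h: "bij_betw h (UNIV :: 'n set) B"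
    using B(5) by (metis finite_same_card_bij finite)
  define e where "e = (\<lambda>k. case k of Inl i \<Rightarrow> r i | Inr j \<Rightarrow> h j)"
  define T :: "real ^ ('n + 'n) ^ ('n + 'n)" where "T = (\<chi> k. e k)"
  have row: "row k T = e k" for k by (simp add: row_def T_def)
  have hB: "h j \<in> B" for j using h by (auto simp: bij_betw_def)
  have rh: "r i \<bullet> h j = 0" for i j
    using B(1) hB[of j] span_base[of "r i" "range r"] by (auto simp: V_def orthogonal_def)
  have "orthogonal_matrix T"
    unfolding orthogonal_matrix_orthonormal_rows row
  proof (intro conjI allI impI)
    fix k l :: "'n + 'n"
    show "norm (e k) = 1"
      using r B(3) hB by (auto simp: e_def norm_eq_1 split: sum.splits)
    assume "k \<noteq> l"
    then show "orthogonal (e k) (e l)"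
      using r rh B(2) hB h
      by (auto simp: e_def orthogonal_def inner_commute[of "h _" "r _"] pairwise_def bij_betw_def inj_on_def split: sum.splits) blast
  qed
  moreover have "row (Inl i) T = r i" for i by (simp add: row e_def)
  ultimately show ?thesis by (rule that)
qed

text \<open>After completion to an orthogonal matrix the forms r i \<bullet> x are coordinates of a
  rotated vector with the same law. The other coordinates are unconstrained and contribute the
  factor 1.\<close>

lemma emeasure_std_normal_vec_orthonormal_rows:
  fixes r :: "'n::finite \<Rightarrow> real ^ ('n + 'n)" and c :: "real ^ 'n"
  assumes "\<And>i j. r i \<bullet> r j = (if i = j then 1 else 0)"
  shows "emeasure std_normal_vec {x. \<forall>i. r i \<bullet> x \<le> c $ i} = (\<Prod>i\<in>UNIV. emeasure std_normal {..c $ i})"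
proof -
  obtain T :: "real ^ ('n + 'n) ^ ('n + 'n)" where T: "orthogonal_matrix T" "\<And>i. row (Inl i) T = r i"
    using extend_orthonormal_rows[of r] assms by blast
  have comp: "(T *v x) $ Inl i = r i \<bullet> x" for x i
    by (simp add: matrix_vector_mul_component T(2)[symmetric] row_def vec_lambda_eta)
  define A where "A = (\<lambda>k::'n + 'n. case k of Inl i \<Rightarrow> {..c $ i} | Inr _ \<Rightarrow> UNIV)"
  have A: "A k \<in> sets borel" for k by (auto simp: A_def split: sum.splits)
  have all: "(\<forall>k. x $ k \<in> A k) \<longleftrightarrow> (\<forall>i. x $ Inl i \<le> c $ i)" for x :: "real ^ ('n + 'n)"
    by (auto simp: A_def split: sum.splits)
  have [measurable]: "A k \<in> sets borel" for k by (rule A)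
  have "{x :: real ^ ('n + 'n). \<forall>k. x $ k \<in> A k} \<in> sets borel" by measurable
  then have "emeasure std_normal_vec {x. T *v x \<in> {x. \<forall>k. x $ k \<in> A k}} = emeasure std_normal_vec {x :: real ^ ('n + 'n). \<forall>k. x $ k \<in> A k}"
    by (rule std_normal_vec_orthogonal_invariant[OF T(1)])
  also have "\<dots> = (\<Prod>k\<in>UNIV. emeasure std_normal (A k))"
    by (rule emeasure_std_normal_vec_box[OF A])
  also have "\<dots> = (\<Prod>i\<in>UNIV. emeasure std_normal (A (Inl i))) * (\<Prod>i\<in>UNIV. emeasure std_normal (A (Inr i)))"
    by (rule prod_UNIV_sum)
  also have "\<dots> = (\<Prod>i\<in>UNIV. emeasure std_normal {..c $ i})"
    using prob_space.emeasure_space_1[OF prob_space_std_normal] by (simp add: A_def)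
  finally show ?thesis by (simp add: all comp)
qed

text \<open>With a sum type as index, a pair of n-vectors is again a vector, to which the result on
  orthonormal rows applies.\<close>

definition vec_join :: "real ^ 'n \<Rightarrow> real ^ 'n \<Rightarrow> real ^ ('n + 'n)" where
  "vec_join z w = (\<chi> k. case k of Inl i \<Rightarrow> z $ i | Inr i \<Rightarrow> w $ i)"

lemma vec_join_inner: "vec_join z w \<bullet> vec_join z' w' = z \<bullet> z' + w \<bullet> w'"
  by (simp add: inner_vec_def vec_join_def sum_UNIV_sum)

lemma measurable_vec_join [measurable]: "(\<lambda>(z, w). vec_join z w) \<in> borel \<Otimes>\<^sub>M borel \<rightarrow>\<^sub>M borel"
proof -
  have "(\<lambda>(z, w). vec_join z w) \<in> borel_measurable (borel :: ((real ^ 'n) \<times> (real ^ 'n)) measure)"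
  proof (intro borel_measurable_continuous_onI)
    have "continuous_on UNIV (\<lambda>p. case k of Inl i \<Rightarrow> fst p $ i | Inr i \<Rightarrow> snd p $ i)" for k :: "'n + 'n"
      by (cases k) (auto intro!: continuous_intros)
    then show "continuous_on UNIV (\<lambda>(z :: real ^ 'n, w). vec_join z w)"
      unfolding vec_join_def case_prod_unfold by (intro continuous_on_vec_lambda)
  qed
  then show ?thesis by (simp add: borel_prod)
qed

lemma distr_vec_join: "distr (std_normal_vec \<Otimes>\<^sub>M std_normal_vec) borel (\<lambda>(z :: real ^ 'n, w). vec_join z w) = std_normal_vec"
proof (rule measure_eqI_orthants)
  interpret P: prob_space "std_normal_vec :: (real ^ 'n) measure" by (rule prob_space_std_normal_vec)
  interpret PP: pair_prob_space "std_normal_vec :: (real ^ 'n) measure" "std_normal_vec :: (real ^ 'n) measure" ..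
  have meas [measurable]: "(\<lambda>(z :: real ^ 'n, w). vec_join z w) \<in> std_normal_vec \<Otimes>\<^sub>M std_normal_vec \<rightarrow>\<^sub>M borel"
    by measurable
  show "finite_measure (distr (std_normal_vec \<Otimes>\<^sub>M std_normal_vec) borel (\<lambda>(z :: real ^ 'n, w). vec_join z w))"
    by (intro PP.finite_measure_distr meas)
  fix c :: "real ^ ('n + 'n)"
  define A where "A = {z :: real ^ 'n. \<forall>i. z $ i \<in> {..c $ Inl i}}"
  define B where "B = {z :: real ^ 'n. \<forall>i. z $ i \<in> {..c $ Inr i}}"
  have [measurable]: "A \<in> sets borel" "B \<in> sets borel" unfolding A_def B_def by measurable
  have [measurable]: "{x :: real ^ ('n + 'n). \<forall>i. x $ i \<le> c $ i} \<in> sets borel" by measurable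
  have "(\<lambda>(z :: real ^ 'n, w). vec_join z w) -` {x. \<forall>i. x $ i \<le> c $ i} = A \<times> B"
    by (auto simp: A_def B_def vec_join_def split: sum.splits)
  then have "emeasure (distr (std_normal_vec \<Otimes>\<^sub>M std_normal_vec) borel (\<lambda>(z :: real ^ 'n, w). vec_join z w)) {x. \<forall>i. x $ i \<le> c $ i}
      = emeasure (std_normal_vec \<Otimes>\<^sub>M std_normal_vec) (A \<times> B)"
    by (subst emeasure_distr) (simp_all add: space_pair_measure)
  also have "\<dots> = emeasure std_normal_vec A * emeasure std_normal_vec B"
    by (rule P.emeasure_pair_measure_Times) simp_all
  also have "\<dots> = (\<Prod>i\<in>UNIV. emeasure std_normal {..c $ Inl i}) * (\<Prod>i\<in>UNIV. emeasure std_normal {..c $ Inr i})"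
    unfolding A_def B_def by (simp only: emeasure_std_normal_vec_box atMost_borel)
  also have "\<dots> = (\<Prod>k\<in>UNIV. emeasure std_normal {..c $ k})"
    by (rule prod_UNIV_sum[symmetric])
  also have "\<dots> = emeasure std_normal_vec {x. \<forall>i. x $ i \<in> {..c $ i}}"
    by (rule emeasure_std_normal_vec_box[symmetric]) simp
  finally show "emeasure (distr (std_normal_vec \<Otimes>\<^sub>M std_normal_vec) borel (\<lambda>(z :: real ^ 'n, w). vec_join z w)) {x. \<forall>i. x $ i \<le> c $ i}
      = emeasure std_normal_vec {x. \<forall>i. x $ i \<le> c $ i}"
    by simp
qed simp_all

section \<open>The moment generating function\<close>

definition std_normal_cdf :: "real \<Rightarrow> real" where
  "std_normal_cdf x = measure std_normal {..x}"

lemma std_normal_cdf_deriv: "(std_normal_cdf has_real_derivative 1 / sqrt (2 * pi) * exp (- x\<^sup>2 / 2)) (at x)"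
  and std_normal_cdf_0_pos: "std_normal_cdf 0 > 0"
proof -
  interpret prob_space std_normal by (rule prob_space_std_normal)
  have cont: "isCont std_normal_density x" for x
    unfolding std_normal_density_def[abs_def] by (intro continuous_intros) auto
  have "\<exists>F. \<forall>x. -\<infinity> < ereal x \<longrightarrow> ereal x < \<infinity> \<longrightarrow> (F has_vector_derivative std_normal_density x) (at x)"
    by (rule einterval_antiderivative) (simp_all add: cont)
  then obtain F where "\<forall>x. -\<infinity> < ereal x \<longrightarrow> ereal x < \<infinity> \<longrightarrow> (F has_vector_derivative std_normal_density x) (at x)" ..
  then have F: "(F has_real_derivative std_normal_density x) (at x)" for x
    by (simp add: has_real_derivative_iff_has_vector_derivative)
  have Icc: "measure std_normal {a..x} = F x - F a" if "a \<le> x" for a x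
  proof -
    have "F a \<le> F x"
      by (rule DERIV_nonneg_imp_nondecreasing[OF that]) (use F normal_density_nonneg in blast)
    have "emeasure std_normal {a..x} = (\<integral>\<^sup>+y. ennreal (std_normal_density y) * indicator {a..x} y \<partial>lborel)"
      by (subst emeasure_density) simp_all
    also have "\<dots> = ennreal (F x - F a)"
      by (rule nn_integral_FTC_Icc[OF _ F _ that]) simp_all
    finally show ?thesis using \<open>F a \<le> F x\<close> by (simp add: measure_def)
  qed
  have diff: "std_normal_cdf x = std_normal_cdf a + (F x - F a)" if "a \<le> x" for a x
  proof -
    have "{..x} = {..a} \<union> {a<..x}" using that by auto
    then have "std_normal_cdf x = std_normal_cdf a + measure std_normal {a<..x}"
      unfolding std_normal_cdf_def by (subst finite_measure_Union[symmetric]) auto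
    also have "measure std_normal {a<..x} = measure std_normal {a..x}"
    proof -
      have "{a..x} = {a} \<union> {a<..x}" using that by auto
      then have "measure std_normal {a..x} = measure std_normal {a} + measure std_normal {a<..x}"
        by (simp only:) (rule finite_measure_Union; auto)
      moreover have "measure std_normal {a} = 0" using Icc[of a a] by simp
      ultimately show ?thesis by simp
    qed
    finally show ?thesis using Icc[OF that] by simp
  qed
  define k where "k = std_normal_cdf 0 - F 0"
  have eq: "std_normal_cdf = (\<lambda>x. F x + k)"
  proof
    show "std_normal_cdf x = F x + k" for x
      using diff[of 0 x] diff[of x 0] by (cases "0 \<le> x") (auto simp: k_def)
  qed
  show "(std_normal_cdf has_real_derivative 1 / sqrt (2 * pi) * exp (- x\<^sup>2 / 2)) (at x)"
    by (subst eq) (auto intro!: derivative_eq_intros F simp: std_normal_density_def)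
  have "F (- 1) < F 0"
  proof -
    have "0 < std_normal_density x" for x by (simp add: normal_density_pos)
    then have "\<exists>y. (F has_real_derivative y) (at x) \<and> y > 0" for x using F by metis
    then show ?thesis by (intro DERIV_pos_imp_increasing[of "- 1" 0 F]) simp_all
  qed
  then show "std_normal_cdf 0 > 0"
    using diff[of "- 1" 0] by (simp add: std_normal_cdf_def add_nonneg_pos)
qed

section \<open>Matrix factorisation of the parameters\<close>

lemma matrix_inv_eqI:
  fixes A X :: "real ^ 'n ^ 'n"
  assumes "A ** X = mat 1" "X ** A = mat 1"
  shows "matrix_inv A = X"
proof -
  have "A ** matrix_inv A = mat 1 \<and> matrix_inv A ** A = mat 1"
    unfolding matrix_inv_def by (rule someI[of _ X]) (use assms in simp)
  then show ?thesis
    using assms by (metis matrix_mul_assoc matrix_mul_lid matrix_mul_rid)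
qed

lemma pos_def_factor:
  fixes \<Omega> :: "real ^ 'n ^ 'n"
  assumes "pos_def \<Omega>"
  obtains B Bi :: "real ^ 'n ^ 'n" where "B ** transpose B = \<Omega>" "B ** Bi = mat 1" "Bi ** B = mat 1"
proof -
  have "pos_semidef \<Omega>"
    using assms unfolding pos_def_def pos_semidef_def
    by (metis inner_zero_left less_imp_le order_refl)
  then obtain B :: "real ^ 'n ^ 'n" where B: "B ** transpose B = \<Omega>" using pos_semidef_factor by blast
  have "x = 0" if "transpose B *v x = 0" for x
  proof (rule ccontr)
    assume "x \<noteq> 0"
    then have "0 < x \<bullet> (\<Omega> *v x)" using assms by (simp add: pos_def_def)
    moreover have "\<Omega> *v x = B *v (transpose B *v x)" by (simp only: B[symmetric] matrix_vector_mul_assoc)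
    ultimately show False using that by simp
  qed
  then obtain X where "X ** transpose B = mat 1"
    using matrix_left_invertible_ker[of "transpose B"] by auto
  then have "B ** transpose X = mat 1"
    by (metis matrix_transpose_mul transpose_mat transpose_transpose)
  then show ?thesis using that[OF B] matrix_left_right_inverse by blast
qed

text \<open>Cauchy-Schwarz applied to |C x|^2 = x \<bullet> C' (C x), followed by division by |C
  x|.\<close>

lemma contraction_transpose:
  fixes C :: "real ^ 'n ^ 'm"
  assumes "\<And>y. norm (transpose C *v y) \<le> norm y"
  shows "norm (C *v x) \<le> norm x"
proof (cases "C *v x = 0")
  case False
  have "(norm (C *v x))\<^sup>2 = x \<bullet> (transpose C *v (C *v x))"
    using dot_matrix_vector_transpose[of x "transpose C" "C *v x"] by (simp add: power2_norm_eq_inner)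
  also have "\<dots> \<le> norm x * norm (transpose C *v (C *v x))" by (rule norm_cauchy_schwarz)
  also have "\<dots> \<le> norm x * norm (C *v x)" by (intro mult_left_mono assms) simp
  finally show ?thesis using False by (simp add: power2_eq_square)
qed simp

lemma measurable_matrix_vector_mult [measurable]: "(*v) (A :: real ^ 'n ^ 'm) \<in> borel_measurable borel"
  by (intro borel_measurable_continuous_onI linear_continuous_on linear_conv_bounded_linear[THEN iffD1]) simp

text \<open>Names the matrix picked by the choice in \<open>centered_normal\<close>; later arguments
  use only that it is a factor of S.\<close>

lemma normal_cdf_eq:
  fixes S :: "real ^ 'n ^ 'n"
  assumes "pos_semidef S"
  obtains A :: "real ^ 'n ^ 'n" where "A ** transpose A = S"
    and "\<And>y. normal_cdf y S = measure std_normal_vec {z. \<forall>i. (A *v z) $ i \<le> y $ i}"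
proof -
  define A :: "real ^ 'n ^ 'n" where "A = (SOME A. A ** transpose A = S)"
  have "A ** transpose A = S"
    unfolding A_def using pos_semidef_factor[OF assms] by (rule someI_ex)
  moreover have "normal_cdf y S = measure std_normal_vec {z. \<forall>i. (A *v z) $ i \<le> y $ i}" for y
    unfolding normal_cdf_def centered_normal_def A_def[symmetric]
    by (subst measure_distr) (auto simp: vimage_def)
  ultimately show ?thesis by (rule that)
qed

text \<open>For independent standard normal z and w the vector A z - D w has covariance A A' + D D'
  = I, so its coordinates are independent and standard normal. The left side is the probability that
  it is at most q in every coordinate.\<close>

lemma gaussian_mixture_orthant:
  fixes A D :: "real ^ 'n ^ 'n" and q :: "real ^ 'n"
  assumes AD: "A ** transpose A + D ** transpose D = mat 1"
  shows "(\<integral>\<^sup>+w. ennreal (measure std_normal_vec {z. \<forall>i. (A *v z) $ i \<le> (D *v w + q) $ i}) \<partial>std_normal_vec) =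
    ennreal (\<Prod>i\<in>UNIV. std_normal_cdf (q $ i))"
proof -
  interpret P: prob_space "std_normal_vec :: (real ^ 'n) measure" by (rule prob_space_std_normal_vec)
  interpret N: prob_space std_normal by (rule prob_space_std_normal)
  \<comment> \<open>The rows of the block matrix (-D, A) acting on the joined vector; their Gram
    matrix is A A' + D D'.\<close>
  define r where "r = (\<lambda>i. vec_join (- row i D) (row i A))"
  define Q where "Q = {x. \<forall>i. r i \<bullet> x \<le> q $ i}"
  define R where "R = {p :: (real ^ 'n) \<times> (real ^ 'n). \<forall>i. (A *v snd p) $ i \<le> (D *v fst p + q) $ i}"
  have r: "r i \<bullet> r j = (if i = j then 1 else 0)" for i j
  proof -
    have "r i \<bullet> r j = (A ** transpose A + D ** transpose D) $ i $ j"
      by (simp add: r_def vec_join_inner matrix_mult_transpose_dot_row)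
    then show ?thesis by (simp add: AD mat_def)
  qed
  have [measurable]: "Q \<in> sets borel" unfolding Q_def by measurable
  have R: "R = (\<lambda>(w, z). vec_join w z) -` Q"
    by (auto simp: R_def Q_def r_def vec_join_inner matrix_vector_mul_component row_def vec_lambda_eta algebra_simps)
  have R_sets: "R \<in> sets (std_normal_vec \<Otimes>\<^sub>M std_normal_vec)"
    unfolding R using measurable_sets[OF measurable_vec_join, of Q] by (simp add: space_pair_measure)
  have "(\<integral>\<^sup>+w. ennreal (measure std_normal_vec {z. \<forall>i. (A *v z) $ i \<le> (D *v w + q) $ i}) \<partial>std_normal_vec) =
      (\<integral>\<^sup>+w. emeasure std_normal_vec (Pair w -` R) \<partial>std_normal_vec)"
    by (simp add: R_def vimage_def P.emeasure_eq_measure)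
  also have "\<dots> = emeasure (std_normal_vec \<Otimes>\<^sub>M std_normal_vec) R"
    by (rule P.emeasure_pair_measure_alt[OF R_sets, symmetric])
  also have "\<dots> = emeasure (distr (std_normal_vec \<Otimes>\<^sub>M std_normal_vec) borel (\<lambda>(z :: real ^ 'n, w). vec_join z w)) Q"
    by (subst emeasure_distr) (simp_all add: R space_pair_measure)
  also have "\<dots> = (\<Prod>i\<in>UNIV. emeasure std_normal {..q $ i})"
    unfolding distr_vec_join Q_def by (rule emeasure_std_normal_vec_orthonormal_rows[OF r])
  also have "\<dots> = ennreal (\<Prod>i\<in>UNIV. std_normal_cdf (q $ i))"
    by (simp add: N.emeasure_eq_measure prod_ennreal std_normal_cdf_def)
  finally show ?thesis .
qed

text \<open>With \<Omega> = B B' and \<Lambda> = B C one has \<Gamma> = B (I - C C') B' and \<Delta>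
  = I - C' C. Semidefiniteness of \<Gamma> says that C' is a contraction; then so is C, which makes
  \<Delta> semidefinite and gives \<Delta> = A A'.\<close>

lemma cfusn_factor:
  fixes \<Omega> \<Lambda> :: "real ^ 'n ^ 'n"
  assumes "cfusn_admissible \<Omega> \<Lambda>"
  obtains A B C :: "real ^ 'n ^ 'n" where "B ** transpose B = \<Omega>" "det B \<noteq> 0" "B ** C = \<Lambda>"
    and "\<And>w. (B *v w) \<bullet> (matrix_inv \<Omega> *v (B *v w)) = w \<bullet> w"
    and "transpose \<Lambda> ** matrix_inv \<Omega> ** B = transpose C"
    and "A ** transpose A + transpose C ** transpose (transpose C) = mat 1"
    and "\<And>y. normal_cdf y (cfusn_Delta \<Omega> \<Lambda>) = measure std_normal_vec {z. \<forall>i. (A *v z) $ i \<le> y $ i}"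
proof -
  obtain B Bi :: "real ^ 'n ^ 'n" where B: "B ** transpose B = \<Omega>" "B ** Bi = mat 1" "Bi ** B = mat 1"
    using pos_def_factor assms unfolding cfusn_admissible_def by blast
  define C where "C = Bi ** \<Lambda>"
  have BC: "B ** C = \<Lambda>" by (simp add: C_def matrix_mul_assoc B)
  have T: "transpose B ** transpose Bi = mat 1" "transpose Bi ** transpose B = mat 1"
    by (metis B(2,3) matrix_transpose_mul transpose_mat)+
  have inv: "matrix_inv \<Omega> = transpose Bi ** Bi"
  proof (rule matrix_inv_eqI)
    have "\<Omega> ** (transpose Bi ** Bi) = B ** (transpose B ** transpose Bi) ** Bi"
      by (simp add: B(1)[symmetric] matrix_mul_assoc)
    then show "\<Omega> ** (transpose Bi ** Bi) = mat 1" by (simp add: T B)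
    have "transpose Bi ** Bi ** \<Omega> = transpose Bi ** (Bi ** B) ** transpose B"
      by (simp add: B(1)[symmetric] matrix_mul_assoc)
    then show "transpose Bi ** Bi ** \<Omega> = mat 1" by (simp add: T B)
  qed
  have det: "det B \<noteq> 0" using B(2) by (metis det_I det_mul mult_zero_left zero_neq_one)
  have form: "(B *v w) \<bullet> (matrix_inv \<Omega> *v (B *v w)) = w \<bullet> w" for w
  proof -
    have "matrix_inv \<Omega> *v (B *v w) = transpose Bi *v ((Bi ** B) *v w)"
      by (simp add: inv matrix_vector_mul_assoc matrix_mul_assoc del: transpose_matrix_vector)
    then have "(B *v w) \<bullet> (matrix_inv \<Omega> *v (B *v w)) = (Bi *v (B *v w)) \<bullet> w"
      using dot_matrix_vector_transpose[of "B *v w" "transpose Bi" w] by (simp add: B del: transpose_matrix_vector)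
    then show ?thesis by (simp add: matrix_vector_mul_assoc B)
  qed
  have L: "transpose \<Lambda> ** matrix_inv \<Omega> ** B = transpose C"
    by (simp add: inv C_def matrix_transpose_mul matrix_mul_assoc[symmetric] B)
  have Delta: "cfusn_Delta \<Omega> \<Lambda> = mat 1 - transpose C ** C"
    unfolding cfusn_Delta_def inv C_def by (simp add: matrix_transpose_mul matrix_mul_assoc)
  have contr: "norm (transpose C *v y) \<le> norm y" for y
  proof -
    \<comment> \<open>For this x, with B' x = y, the form of \<Gamma> is |y|^2 - |C' y|^2.\<close>
    define x where "x = transpose Bi *v y"
    have y: "transpose B *v x = y"
      by (simp add: x_def matrix_vector_mul_assoc T del: transpose_matrix_vector)
    have "transpose \<Lambda> *v x = transpose C *v y"
      by (simp add: BC[symmetric] matrix_transpose_mul y[symmetric] matrix_vector_mul_assoc del: transpose_matrix_vector)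
    moreover have sq: "x \<bullet> ((M ** transpose M) *v x) = (norm (transpose M *v x))\<^sup>2" for M :: "real ^ 'n ^ 'n"
      by (simp add: matrix_vector_mul_assoc[symmetric] dot_matrix_vector_transpose[of x M] power2_norm_eq_inner
          del: transpose_matrix_vector)
    moreover have "0 \<le> x \<bullet> (cfusn_Gamma \<Omega> \<Lambda> *v x)"
      using assms by (simp add: cfusn_admissible_def pos_semidef_def)
    ultimately have "(norm (transpose C *v y))\<^sup>2 \<le> (norm y)\<^sup>2"
      by (simp add: cfusn_Gamma_def matrix_vector_mult_diff_rdistrib inner_diff_right B(1)[symmetric] sq y
          del: transpose_matrix_vector)
    then show ?thesis by (simp add: power2_le_iff_abs_le)
  qed
  have psd: "pos_semidef (cfusn_Delta \<Omega> \<Lambda>)"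
    unfolding Delta pos_semidef_def
  proof (intro conjI allI)
    have "transpose (mat 1 - transpose C ** C) = transpose (mat 1) - transpose (transpose C ** C)"
      by (simp add: transpose_def vec_eq_iff)
    then show "transpose (mat 1 - transpose C ** C) = mat 1 - transpose C ** C"
      by (simp add: matrix_transpose_mul)
    fix x
    have "(norm (C *v x))\<^sup>2 \<le> (norm x)\<^sup>2"
      using contraction_transpose[OF contr] by (simp add: power_mono)
    moreover have "x \<bullet> ((transpose C ** C) *v x) = (norm (C *v x))\<^sup>2"
      using dot_matrix_vector_transpose[of x "transpose C" "C *v x"]
      by (simp add: matrix_vector_mul_assoc[symmetric] power2_norm_eq_inner del: transpose_matrix_vector)
    ultimately show "0 \<le> x \<bullet> ((mat 1 - transpose C ** C) *v x)"
      by (simp add: matrix_vector_mult_diff_rdistrib inner_diff_right power2_norm_eq_inner)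
  qed
  obtain A :: "real ^ 'n ^ 'n" where A: "A ** transpose A = cfusn_Delta \<Omega> \<Lambda>"
    "\<And>y. normal_cdf y (cfusn_Delta \<Omega> \<Lambda>) = measure std_normal_vec {z. \<forall>i. (A *v z) $ i \<le> y $ i}"
    using normal_cdf_eq[OF psd] by blast
  have "A ** transpose A + transpose C ** transpose (transpose C) = mat 1"
    by (simp add: A(1) Delta)
  from that[OF B(1) det BC form L this A(2)] show ?thesis .
qed

text \<open>The substitution x = \<mu> + B (b + w) with b = B' t standardises the Gaussian and
  completes the square. The exponential tilt becomes a shift by q = C' b in the argument of the cdf,
  whose Gaussian average is given by \<open>gaussian_mixture_orthant\<close>.\<close>

lemma nn_integral_exp_CFUSN:
  fixes \<Omega> \<Lambda> :: "real ^ 'n ^ 'n" and \<mu> t :: "real ^ 'n"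
  assumes "cfusn_admissible \<Omega> \<Lambda>"
  shows "(\<integral>\<^sup>+x. ennreal (exp (t \<bullet> x)) \<partial>CFUSN \<mu> \<Omega> \<Lambda>) =
    ennreal (2 ^ CARD('n) * (exp (t \<bullet> \<mu> + (t \<bullet> (\<Omega> *v t)) / 2) * (\<Prod>i\<in>UNIV. std_normal_cdf (t \<bullet> column i \<Lambda>))))"
proof -
  obtain A B C :: "real ^ 'n ^ 'n" where B: "B ** transpose B = \<Omega>" "det B \<noteq> 0" and C: "B ** C = \<Lambda>"
    and form: "\<And>w. (B *v w) \<bullet> (matrix_inv \<Omega> *v (B *v w)) = w \<bullet> w"
    and L: "transpose \<Lambda> ** matrix_inv \<Omega> ** B = transpose C"
    and A: "A ** transpose A + transpose C ** transpose (transpose C) = mat 1"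
    and cdf: "\<And>y. normal_cdf y (cfusn_Delta \<Omega> \<Lambda>) = measure std_normal_vec {z. \<forall>i. (A *v z) $ i \<le> y $ i}"
    by (rule cfusn_factor[OF assms], rule that)
  interpret P: prob_space "std_normal_vec :: (real ^ 'n) measure" by (rule prob_space_std_normal_vec)
  define G where "G = (\<lambda>y. measure std_normal_vec {z. \<forall>i. (A *v z) $ i \<le> y $ i})"
  define n where "n = (\<lambda>w :: real ^ 'n. \<Prod>i\<in>UNIV. std_normal_density (w $ i))"
  define b where "b = transpose B *v t"
  define q where "q = transpose C *v b"
  define \<kappa> where "\<kappa> = 2 ^ CARD('n) * exp (t \<bullet> \<mu> + (t \<bullet> (\<Omega> *v t)) / 2)"
  have \<kappa>: "\<kappa> \<ge> 0" by (simp add: \<kappa>_def)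
  have n_nonneg: "n w \<ge> 0" for w by (simp add: n_def prod_nonneg)
  have [measurable]: "n \<in> borel_measurable borel" unfolding n_def by measurable
  \<comment> \<open>\<open>G\<close> measures the sections of a closed set in the product space,
    hence is measurable in the section parameter.\<close>
  have [measurable]: "G \<in> borel_measurable borel"
  proof -
    have "{p :: (real ^ 'n) \<times> (real ^ 'n). \<forall>i. (A *v snd p) $ i \<le> fst p $ i} \<in> sets (borel \<Otimes>\<^sub>M std_normal_vec)"
    proof -
      have "closed {p :: (real ^ 'n) \<times> (real ^ 'n). \<forall>i. (A *v snd p) $ i \<le> fst p $ i}"
        by (intro closed_Collect_all closed_Collect_le continuous_intros linear_continuous_on_compose[where g = "(*v) A"]) simp
      moreover have "sets ((borel :: (real ^ 'n) measure) \<Otimes>\<^sub>M std_normal_vec) = sets (borel \<Otimes>\<^sub>M (borel :: (real ^ 'n) measure))"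
        by (intro sets_pair_measure_cong) simp_all
      ultimately show ?thesis by (simp only: borel_prod borel_closed)
    qed
    from P.measurable_emeasure_Pair[OF this] show ?thesis
      by (simp add: G_def vimage_def measure_def)
  qed
  have [measurable]: "(\<lambda>x. normal_pdf x \<Omega>) \<in> borel_measurable borel"
    unfolding normal_pdf_def by measurable
  have pdf: "cfusn_pdf \<mu> \<Omega> \<Lambda> x = 2 ^ CARD('n) * normal_pdf (x - \<mu>) \<Omega> * G ((transpose \<Lambda> ** matrix_inv \<Omega>) *v (x - \<mu>))" for x
    by (simp add: cfusn_pdf_def cdf G_def)
  have [measurable]: "cfusn_pdf \<mu> \<Omega> \<Lambda> \<in> borel_measurable borel"
    unfolding pdf[abs_def] by measurable
  have b: "t \<bullet> (B *v w) = b \<bullet> w" for w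
    by (simp add: b_def dot_matrix_vector_transpose del: transpose_matrix_vector)
  have bb: "b \<bullet> b = t \<bullet> (\<Omega> *v t)"
  proof -
    have "\<Omega> *v t = B *v b" by (simp only: b_def matrix_vector_mul_assoc B)
    then show ?thesis by (simp only: b)
  qed
  have q: "q $ i = t \<bullet> column i \<Lambda>" for i
  proof -
    have "q = transpose \<Lambda> *v t"
      by (simp add: q_def b_def matrix_vector_mul_assoc C[symmetric] matrix_transpose_mul del: transpose_matrix_vector)
    then show ?thesis
      by (simp add: matrix_vector_mul_component column_def transpose_def inner_commute del: transpose_matrix_vector)
  qed
  \<comment> \<open>The determinant of \<Omega> is the square of that of B, so the Jacobian cancels
    the normalisation of the density.\<close>
  have npdf: "\<bar>det B\<bar> * normal_pdf (B *v w) \<Omega> = n w" for w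
  proof -
    have "det \<Omega> = (det B)\<^sup>2" by (simp add: B(1)[symmetric] det_mul det_transpose power2_eq_square)
    then have "sqrt ((2 * pi) ^ CARD('n) * det \<Omega>) = sqrt (2 * pi) ^ CARD('n) * \<bar>det B\<bar>"
      by (simp only: real_sqrt_mult[of "(2 * pi) ^ CARD('n)"] real_sqrt_power[of "2 * pi"] real_sqrt_abs)
    then show ?thesis using B(2)
      by (simp add: normal_pdf_def n_def prod_std_normal_density form)
  qed
  have shift: "exp (b \<bullet> (b + w)) * n (b + w) = exp (b \<bullet> b / 2) * n w" for w
  proof -
    have "b \<bullet> (b + w) + - ((b + w) \<bullet> (b + w)) / 2 = b \<bullet> b / 2 + - (w \<bullet> w) / 2"
      by (simp add: inner_add_left inner_add_right inner_commute[of w b] field_simps)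
    then show ?thesis
      unfolding n_def prod_std_normal_density by (simp only: times_divide_eq_right exp_add[symmetric])
  qed
  have point: "ennreal \<bar>det B\<bar> * ennreal (exp (t \<bullet> (\<mu> + B *v (b + w))) * cfusn_pdf \<mu> \<Omega> \<Lambda> (\<mu> + B *v (b + w))) =
      ennreal \<kappa> * (ennreal (n w) * ennreal (G (transpose C *v w + q)))" for w
  proof -
    have "(transpose \<Lambda> ** matrix_inv \<Omega>) *v (B *v (b + w)) = transpose C *v w + q"
      by (simp add: matrix_vector_mul_assoc L q_def matrix_vector_right_distrib add.commute del: transpose_matrix_vector)
    then have "\<bar>det B\<bar> * (exp (t \<bullet> (\<mu> + B *v (b + w))) * cfusn_pdf \<mu> \<Omega> \<Lambda> (\<mu> + B *v (b + w))) =
        2 ^ CARD('n) * exp (t \<bullet> \<mu>) * exp (b \<bullet> (b + w)) * (\<bar>det B\<bar> * normal_pdf (B *v (b + w)) \<Omega>) * G (transpose C *v w + q)"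
      by (simp only: pdf add_diff_cancel_left' inner_add_right[of t \<mu>] b exp_add mult_ac)
    also have "\<dots> = 2 ^ CARD('n) * exp (t \<bullet> \<mu>) * (exp (b \<bullet> (b + w)) * n (b + w)) * G (transpose C *v w + q)"
      by (simp only: npdf mult.assoc)
    also have "\<dots> = \<kappa> * (n w * G (transpose C *v w + q))"
      unfolding shift by (simp only: \<kappa>_def bb exp_add mult_ac)
    finally have "\<bar>det B\<bar> * (exp (t \<bullet> (\<mu> + B *v (b + w))) * cfusn_pdf \<mu> \<Omega> \<Lambda> (\<mu> + B *v (b + w))) =
        \<kappa> * (n w * G (transpose C *v w + q))" .
    moreover have "G y \<ge> 0" for y by (simp add: G_def)
    ultimately show ?thesis using \<kappa> n_nonneg by (simp add: ennreal_mult[symmetric] ennreal_mult'[symmetric])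
  qed
  define h where "h = (\<lambda>x. ennreal (exp (t \<bullet> x) * cfusn_pdf \<mu> \<Omega> \<Lambda> x))"
  have [measurable]: "h \<in> borel_measurable borel" unfolding h_def by measurable
  have "(\<integral>\<^sup>+x. ennreal (exp (t \<bullet> x)) \<partial>CFUSN \<mu> \<Omega> \<Lambda>) = (\<integral>\<^sup>+x. h x \<partial>lborel)"
    unfolding CFUSN_def by (subst nn_integral_density) (simp_all add: h_def ennreal_mult' mult.commute)
  also have "\<dots> = (\<integral>\<^sup>+x. h (\<mu> + x) \<partial>lborel)"
    by (rule nn_integral_lborel_translate[symmetric]) simp
  also have "\<dots> = ennreal \<bar>det B\<bar> * (\<integral>\<^sup>+w. h (\<mu> + B *v w) \<partial>lborel)"
    using nn_integral_lborel_linear[of "(*v) B" "\<lambda>x. h (\<mu> + x)"] B(2) by simp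
  also have "\<dots> = ennreal \<bar>det B\<bar> * (\<integral>\<^sup>+w. h (\<mu> + B *v (b + w)) \<partial>lborel)"
    by (subst nn_integral_lborel_translate[where c = b, symmetric]) simp_all
  also have "\<dots> = (\<integral>\<^sup>+w. ennreal \<bar>det B\<bar> * h (\<mu> + B *v (b + w)) \<partial>lborel)"
    by (rule nn_integral_cmult[symmetric]) simp
  also have "\<dots> = (\<integral>\<^sup>+w. ennreal \<kappa> * (ennreal (n w) * ennreal (G (transpose C *v w + q))) \<partial>lborel)"
    unfolding h_def point ..
  also have "\<dots> = ennreal \<kappa> * (\<integral>\<^sup>+w. ennreal (n w) * ennreal (G (transpose C *v w + q)) \<partial>lborel)"
    by (rule nn_integral_cmult) (simp del: transpose_matrix_vector)
  also have "(\<integral>\<^sup>+w. ennreal (n w) * ennreal (G (transpose C *v w + q)) \<partial>lborel) =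
      (\<integral>\<^sup>+w. ennreal (G (transpose C *v w + q)) \<partial>std_normal_vec)"
  proof -
    have std: "std_normal_vec = density lborel (\<lambda>w. ennreal (n w))" by (simp add: std_normal_vec_def n_def)
    show ?thesis
      unfolding std by (rule nn_integral_density[symmetric]) (simp_all del: transpose_matrix_vector)
  qed
  also have "\<dots> = ennreal (\<Prod>i\<in>UNIV. std_normal_cdf (q $ i))"
    unfolding G_def by (rule gaussian_mixture_orthant[OF A])
  also have "ennreal \<kappa> * \<dots> = ennreal (\<kappa> * (\<Prod>i\<in>UNIV. std_normal_cdf (t \<bullet> column i \<Lambda>)))"
    using \<kappa> by (simp add: q ennreal_mult')
  finally show ?thesis by (simp add: \<kappa>_def mult.assoc)
qed

text \<open>One direction has to serve both forms, since the analytic argument takes place on a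
  single line.\<close>

lemma symmetric_forms_common_nonzero:
  fixes M N :: "real ^ 'n ^ 'n"
  assumes M: "transpose M = M" "M \<noteq> 0" and N: "transpose N = N" "N \<noteq> 0"
  obtains t where "t \<bullet> (M *v t) \<noteq> 0" "t \<bullet> (N *v t) \<noteq> 0"
proof -
  obtain u where u: "u \<bullet> (M *v u) \<noteq> 0" using symmetric_form_zero M by blast
  obtain v where v: "v \<bullet> (N *v v) \<noteq> 0" using symmetric_form_zero N by blast
  show ?thesis
  proof (cases "u \<bullet> (N *v u) = 0 \<and> v \<bullet> (M *v v) = 0")
    case False
    then show ?thesis using that u v by blast
  next
    case True
    have expand: "(u + e *\<^sub>R v) \<bullet> (S *v (u + e *\<^sub>R v)) = u \<bullet> (S *v u) + e * (u \<bullet> (S *v v) + v \<bullet> (S *v u)) + e * e * (v \<bullet> (S *v v))"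
      for e and S :: "real ^ 'n ^ 'n"
      by (simp add: matrix_vector_right_distrib matrix_vector_mult_scaleR inner_add_left inner_add_right algebra_simps)
    define a where "a = u \<bullet> (M *v u)"
    define a' where "a' = u \<bullet> (M *v v) + v \<bullet> (M *v u)"
    define c where "c = v \<bullet> (N *v v)"
    define c' where "c' = u \<bullet> (N *v v) + v \<bullet> (N *v u)"
    \<comment> \<open>These are the two forms on the line u + e v, with a and c nonzero. Each
      vanishes for at most one nonzero e, so one of e = 1, 2, -1 works.\<close>
    have "\<exists>e. a + e * a' \<noteq> 0 \<and> e * c' + e * e * c \<noteq> 0"
    proof (rule ccontr)
      assume "\<not> ?thesis"
      then have "a + e * a' = 0 \<or> e * c' + e * e * c = 0" for e by blast
      from this[of 1] this[of 2] this[of "-1"] show False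
        using u v by (auto simp: a_def[symmetric] c_def[symmetric])
    qed
    then obtain e where "a + e * a' \<noteq> 0" "e * c' + e * e * c \<noteq> 0" by blast
    then have "(u + e *\<^sub>R v) \<bullet> (M *v (u + e *\<^sub>R v)) \<noteq> 0" "(u + e *\<^sub>R v) \<bullet> (N *v (u + e *\<^sub>R v)) \<noteq> 0"
      unfolding expand using True by (simp_all add: a_def a'_def c_def c'_def)
    then show ?thesis by (rule that)
  qed
qed

text \<open>The generating function along s t in the shape that \<open>line_rigidity\<close> takes,
  with \<Omega> split as \<Gamma> + \<Lambda> \<Lambda>'. Only integrals against g occur, so any
  version of the density serves.\<close>

lemma nn_integral_exp_pdf:
  fixes g :: "real ^ 'n \<Rightarrow> real"
  assumes "cfusn_admissible \<Omega> \<Lambda>" "is_pdf_of g (CFUSN \<mu> \<Omega> \<Lambda>)"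
  shows "(\<integral>\<^sup>+x. ennreal (exp ((s *\<^sub>R t) \<bullet> x) * g x) \<partial>lborel) =
    ennreal (2 ^ CARD('n) * (exp (s * (t \<bullet> \<mu>) + s\<^sup>2 * (t \<bullet> (cfusn_Gamma \<Omega> \<Lambda> *v t) + (\<Sum>i\<in>UNIV. (t \<bullet> column i \<Lambda>)\<^sup>2)) / 2) *
      (\<Prod>i\<in>UNIV. std_normal_cdf (s * (t \<bullet> column i \<Lambda>)))))"
proof -
  have g: "g \<in> borel_measurable borel" "\<And>x. 0 \<le> g x" "CFUSN \<mu> \<Omega> \<Lambda> = density lborel (\<lambda>x. ennreal (g x))"
    using assms(2) by (auto simp: is_pdf_of_def)
  have "(\<Sum>i\<in>UNIV. (t \<bullet> column i \<Lambda>)\<^sup>2) = t \<bullet> ((\<Lambda> ** transpose \<Lambda>) *v t)"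
  proof -
    have "t \<bullet> ((\<Lambda> ** transpose \<Lambda>) *v t) = (transpose \<Lambda> *v t) \<bullet> (transpose \<Lambda> *v t)"
      by (simp add: matrix_vector_mul_assoc[symmetric] dot_matrix_vector_transpose[of t \<Lambda>] del: transpose_matrix_vector)
    moreover have "(transpose \<Lambda> *v t) $ i = t \<bullet> column i \<Lambda>" for i
      by (simp add: matrix_vector_mul_component column_def transpose_def inner_commute del: transpose_matrix_vector)
    ultimately show ?thesis by (simp add: inner_vec_def power2_eq_square del: transpose_matrix_vector)
  qed
  then have \<Omega>: "t \<bullet> (cfusn_Gamma \<Omega> \<Lambda> *v t) + (\<Sum>i\<in>UNIV. (t \<bullet> column i \<Lambda>)\<^sup>2) = t \<bullet> (\<Omega> *v t)"
    by (simp add: cfusn_Gamma_def matrix_vector_mult_diff_rdistrib inner_diff_right)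
  have "(\<integral>\<^sup>+x. ennreal (exp ((s *\<^sub>R t) \<bullet> x) * g x) \<partial>lborel) = (\<integral>\<^sup>+x. ennreal (exp ((s *\<^sub>R t) \<bullet> x)) \<partial>CFUSN \<mu> \<Omega> \<Lambda>)"
    unfolding g(3) using g(1) by (subst nn_integral_density) (simp_all add: ennreal_mult g(2) mult.commute)
  also have "\<dots> = ennreal (2 ^ CARD('n) * (exp ((s *\<^sub>R t) \<bullet> \<mu> + ((s *\<^sub>R t) \<bullet> (\<Omega> *v (s *\<^sub>R t))) / 2) *
      (\<Prod>i\<in>UNIV. std_normal_cdf ((s *\<^sub>R t) \<bullet> column i \<Lambda>))))"
    by (rule nn_integral_exp_CFUSN[OF assms(1)])
  finally show ?thesis
    unfolding \<Omega> by (simp add: matrix_vector_mult_scaleR power2_eq_square mult.assoc)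
qed

lemma cfusn_mixture_rigidity:
  fixes f1 g h :: "real ^ 'n \<Rightarrow> real"
  assumes adm: "cfusn_admissible \<Omega> \<Lambda>" "cfusn_admissible \<Omega>1 \<Lambda>1" "cfusn_admissible \<Omega>0 \<Lambda>0"
    and pdf: "is_pdf_of g (CFUSN \<mu> \<Omega> \<Lambda>)" "is_pdf_of f1 (CFUSN \<mu>1 \<Omega>1 \<Lambda>1)" "is_pdf_of h (CFUSN \<mu>0 \<Omega>0 \<Lambda>0)"
    and c: "0 < c" "c < 1" and mix: "\<And>x. g x = c * f1 x + (1 - c) * h x"
  shows "cfusn_Gamma \<Omega> \<Lambda> = cfusn_Gamma \<Omega>1 \<Lambda>1 \<or> cfusn_Gamma \<Omega>0 \<Lambda>0 = cfusn_Gamma \<Omega>1 \<Lambda>1"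
proof (rule ccontr)
  assume "\<not> ?thesis"
  then have ne: "cfusn_Gamma \<Omega> \<Lambda> - cfusn_Gamma \<Omega>1 \<Lambda>1 \<noteq> 0" "cfusn_Gamma \<Omega>0 \<Lambda>0 - cfusn_Gamma \<Omega>1 \<Lambda>1 \<noteq> 0"
    by simp_all
  have sym: "transpose (cfusn_Gamma \<Omega> \<Lambda> - cfusn_Gamma \<Omega>1 \<Lambda>1) = cfusn_Gamma \<Omega> \<Lambda> - cfusn_Gamma \<Omega>1 \<Lambda>1"
    if "cfusn_admissible \<Omega> \<Lambda>" for \<Omega> \<Lambda> :: "real ^ 'n ^ 'n"
    using that adm(2) by (simp add: cfusn_admissible_def pos_semidef_def transpose_def vec_eq_iff)
  obtain t where t: "t \<bullet> ((cfusn_Gamma \<Omega> \<Lambda> - cfusn_Gamma \<Omega>1 \<Lambda>1) *v t) \<noteq> 0"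
    "t \<bullet> ((cfusn_Gamma \<Omega>0 \<Lambda>0 - cfusn_Gamma \<Omega>1 \<Lambda>1) *v t) \<noteq> 0"
    using symmetric_forms_common_nonzero[OF sym[OF adm(1)] ne(1) sym[OF adm(3)] ne(2)] by blast
  define F where "F = (\<lambda>\<mu> \<Omega> \<Lambda> s. exp (s * (t \<bullet> \<mu>) + s\<^sup>2 * (t \<bullet> (cfusn_Gamma \<Omega> \<Lambda> *v t) + (\<Sum>i\<in>UNIV. (t \<bullet> column i \<Lambda>)\<^sup>2)) / 2) *
      (\<Prod>i\<in>UNIV. std_normal_cdf (s * (t \<bullet> column i \<Lambda>))))"
  \<comment> \<open>Nonnegativity lets the identity between extended nonnegative integrals be read
    as one between real numbers.\<close>
  have F_nonneg: "F \<mu> \<Omega> \<Lambda> s \<ge> 0" for \<mu> \<Omega> \<Lambda> s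
    by (simp add: F_def std_normal_cdf_def prod_nonneg)
  have "F \<mu> \<Omega> \<Lambda> s = c * F \<mu>1 \<Omega>1 \<Lambda>1 s + (1 - c) * F \<mu>0 \<Omega>0 \<Lambda>0 s" for s
  proof -
    have meas [measurable]: "f1 \<in> borel_measurable borel" "h \<in> borel_measurable borel"
      and nonneg: "\<And>x. 0 \<le> f1 x" "\<And>x. 0 \<le> h x"
      using pdf by (auto simp: is_pdf_of_def)
    let ?e = "\<lambda>x. exp ((s *\<^sub>R t) \<bullet> x)"
    have "ennreal (2 ^ CARD('n) * F \<mu> \<Omega> \<Lambda> s) = (\<integral>\<^sup>+x. ennreal (?e x * g x) \<partial>lborel)"
      unfolding F_def by (rule nn_integral_exp_pdf[OF adm(1) pdf(1), symmetric])
    also have "\<dots> = (\<integral>\<^sup>+x. ennreal c * ennreal (?e x * f1 x) + ennreal (1 - c) * ennreal (?e x * h x) \<partial>lborel)"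
    proof (rule nn_integral_cong)
      fix x
      have "?e x * g x = c * (?e x * f1 x) + (1 - c) * (?e x * h x)" by (simp add: mix algebra_simps)
      then show "ennreal (?e x * g x) = ennreal c * ennreal (?e x * f1 x) + ennreal (1 - c) * ennreal (?e x * h x)"
        using c nonneg by (simp add: ennreal_mult[symmetric] ennreal_plus[symmetric] del: ennreal_plus)
    qed
    also have "\<dots> = ennreal c * (\<integral>\<^sup>+x. ennreal (?e x * f1 x) \<partial>lborel) + ennreal (1 - c) * (\<integral>\<^sup>+x. ennreal (?e x * h x) \<partial>lborel)"
      by (simp add: nn_integral_add nn_integral_cmult)
    also have "(\<integral>\<^sup>+x. ennreal (?e x * f1 x) \<partial>lborel) = ennreal (2 ^ CARD('n) * F \<mu>1 \<Omega>1 \<Lambda>1 s)"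
      unfolding F_def by (rule nn_integral_exp_pdf[OF adm(2) pdf(2)])
    also have "(\<integral>\<^sup>+x. ennreal (?e x * h x) \<partial>lborel) = ennreal (2 ^ CARD('n) * F \<mu>0 \<Omega>0 \<Lambda>0 s)"
      unfolding F_def by (rule nn_integral_exp_pdf[OF adm(3) pdf(3)])
    finally have "2 ^ CARD('n) * F \<mu> \<Omega> \<Lambda> s = c * (2 ^ CARD('n) * F \<mu>1 \<Omega>1 \<Lambda>1 s) + (1 - c) * (2 ^ CARD('n) * F \<mu>0 \<Omega>0 \<Lambda>0 s)"
      using c F_nonneg by (simp add: ennreal_mult[symmetric] ennreal_plus[symmetric] del: ennreal_plus)
    then have "2 ^ CARD('n) * F \<mu> \<Omega> \<Lambda> s = 2 ^ CARD('n) * (c * F \<mu>1 \<Omega>1 \<Lambda>1 s + (1 - c) * F \<mu>0 \<Omega>0 \<Lambda>0 s)"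
      by (simp add: algebra_simps)
    then show ?thesis by simp
  qed
  then have "t \<bullet> (cfusn_Gamma \<Omega> \<Lambda> *v t) = t \<bullet> (cfusn_Gamma \<Omega>1 \<Lambda>1 *v t) \<or>
      t \<bullet> (cfusn_Gamma \<Omega>0 \<Lambda>0 *v t) = t \<bullet> (cfusn_Gamma \<Omega>1 \<Lambda>1 *v t)"
    unfolding F_def by (intro line_rigidity[OF std_normal_cdf_deriv _ std_normal_cdf_0_pos c]) simp_all
  then show False using t by (auto simp: matrix_vector_mult_diff_rdistrib inner_diff_right)
qed

theorem theorem3:
  fixes \<mu>1 :: "real ^ 'n" and \<Omega>1 \<Lambda>1 :: "real ^ 'n ^ 'n" and f1 :: "real ^ 'n \<Rightarrow> real"
  assumes "cfusn_admissible \<Omega>1 \<Lambda>1"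
    and "is_pdf_of f1 (CFUSN \<mu>1 \<Omega>1 \<Lambda>1)"
  shows "mixture_identifiable (cfusn_P0 (cfusn_Gamma \<Omega>1 \<Lambda>1)) f1"
proof -
  \<comment> \<open>The two representations are interchangeable, so excluding b < a excludes all
    unequal weights.\<close>
  have less: False
    if ab: "0 < b" "b < a" "a < 1" and P0: "h0 \<in> cfusn_P0 (cfusn_Gamma \<Omega>1 \<Lambda>1)" "g0 \<in> cfusn_P0 (cfusn_Gamma \<Omega>1 \<Lambda>1)"
      and eq: "mix f1 a h0 = mix f1 b g0" for a b :: real and h0 g0
  proof -
    obtain \<mu> \<Omega> \<Lambda> where g: "cfusn_admissible \<Omega> \<Lambda>" "is_pdf_of g0 (CFUSN \<mu> \<Omega> \<Lambda>)" "cfusn_Gamma \<Omega> \<Lambda> \<noteq> cfusn_Gamma \<Omega>1 \<Lambda>1"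
      using P0(2) by (auto simp: cfusn_P0_def)
    obtain \<mu>0 \<Omega>0 \<Lambda>0 where h: "cfusn_admissible \<Omega>0 \<Lambda>0" "is_pdf_of h0 (CFUSN \<mu>0 \<Omega>0 \<Lambda>0)" "cfusn_Gamma \<Omega>0 \<Lambda>0 \<noteq> cfusn_Gamma \<Omega>1 \<Lambda>1"
      using P0(1) by (auto simp: cfusn_P0_def)
    \<comment> \<open>The weight of \<open>f1\<close> when the equality of the mixtures is solved
      for \<open>g0\<close>; it lies strictly between 0 and 1 because b < a < 1.\<close>
    define c where "c = (a - b) / (1 - b)"
    have c: "0 < c" "c < 1" using ab by (simp_all add: c_def)
    have "g0 x = c * f1 x + (1 - c) * h0 x" for x
    proof -
      have "a * f1 x + (1 - a) * h0 x = b * f1 x + (1 - b) * g0 x"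
        using fun_cong[OF eq, of x] by (simp add: mix_def)
      then have "(1 - b) * g0 x = (a - b) * f1 x + (1 - a) * h0 x" by (simp add: algebra_simps)
      then have "g0 x = ((a - b) * f1 x + (1 - a) * h0 x) / (1 - b)"
        using ab by (metis less_trans nonzero_mult_div_cancel_left right_minus_eq less_irrefl)
      moreover have "1 - c = (1 - a) / (1 - b)" using ab by (simp add: c_def field_simps)
      ultimately show ?thesis by (simp add: c_def add_divide_distrib)
    qed
    from cfusn_mixture_rigidity[OF g(1) assms(1) h(1) g(2) assms(2) h(2) c this] g(3) h(3)
    show False by blast
  qed
  show ?thesis
    unfolding mixture_identifiable_def
  proof (intro ballI impI)
    fix a b :: real and h0 g0
    assume ab: "a \<in> {0<..<1}" "b \<in> {0<..<1}" and P0: "h0 \<in> cfusn_P0 (cfusn_Gamma \<Omega>1 \<Lambda>1)" "g0 \<in> cfusn_P0 (cfusn_Gamma \<Omega>1 \<Lambda>1)"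
      and eq: "mix f1 a h0 = mix f1 b g0"
    have "a = b"
      using less[of b a h0 g0] less[of a b g0 h0] ab P0 eq by (cases a b rule: linorder_cases) auto
    moreover have "h0 = g0"
    proof
      fix x
      have "(1 - a) * h0 x = (1 - a) * g0 x"
        using fun_cong[OF eq, of x] \<open>a = b\<close> by (simp add: mix_def)
      then show "h0 x = g0 x" using ab by simp
    qed
    ultimately show "(a, h0) = (b, g0)" by simp
  qed
qed

end
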